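(* Let $A$ be a cellular $R$-algebra with cell datum $(\Lambda,T,C)$ and a family of JM-elements which separate $T(\Lambda)$ over $R$. Then there exist scalars $\{\gamma_{\mathfrak t}\in K : \mathfrak t\in T(\Lambda)\}$ such that, for all $\lambda,\mu\in\Lambda$, $\mathfrak s,\mathfrak t\in T(\lambda)$ and $\mathfrak u,\mathfrak v\in T(\mu)$, $$f^\lambda_{\mathfrak s\mathfrak t}f^\mu_{\mathfrak u\mathfrak v}=\begin{cases}\gamma_{\mathfrak t}f^\lambda_{\mathfrak s\mathfrak v},&\text{if }\lambda=\mu\text{ and }\mathfrak t=\mathfrak u,\\ 0,&\text{otherwise.}\end{cases}$$ In particular, $\gamma_{\mathfrak t}$ depends only on $\mathfrak t\in T(\Lambda)$, and $\{f^\lambda_{\mathfrak s\mathfrak t} : \mathfrak s,\mathfrak t\in T(\lambda),\ \lambda\in\Lambda\}$ is a cellular basis of $A_K$.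
   Context: Let $R$ be a commutative ring with $1$ having a field of fractions $K$ (so $R$ is an integral domain), and let $A$ be a unital $R$-algebra. A cell datum for $A$ is a triple $(\Lambda,T,C)$ where $\Lambda=(\Lambda,>)$ is a finite poset, $T(\lambda)$ is a finite set for each $\lambda\in\Lambda$, and $C:\coprod_{\lambda\in\Lambda}T(\lambda)\times T(\lambda)\to A$, $(\mathfrak s,\mathfrak t)\mapsto a^\lambda_{\mathfrak s\mathfrak t}$, is an injective map such that: (a) $\{a^\lambda_{\mathfrak s\mathfrak t}\}$ is an $R$-free basis of $A$; (b) for any $x\in A$ and $\mathfrak t\in T(\lambda)$ there exist $r_{\mathfrak t\mathfrak v x}\in R$ such that, for all $\mathfrak s\in T(\lambda)$, $a^\lambda_{\mathfrak s\mathfrak t}x\equiv\sum_{\mathfrak v\in T(\lambda)}r_{\mathfrak t\mathfrak v x}a^\lambda_{\mathfrak s\mathfrak v}\pmod{A^\lambda}$, where $A^\lambda$ is the $R$-submodule with basis $\{a^\mu_{\mathfrak y\mathfrak z}:\mu>\lambda,\ \mathfrak y,\mathfrak z\in T(\mu)\}$; (c) the $R$-linear map $*:A\to A$ with $(a^\lambda_{\mathfrak s\mathfrak t})^*=a^\lambda_{\mathfrak t\mathfrak s}$ is an anti-isomorphism of $A$. Then $A$ is called cellular and $\{a^\lambda_{\mathfrak s\mathfrak t}\}$ a cellular basis. Each $T(\lambda)$ carries a partial order $\triangleright_\lambda$. Put $T(\Lambda)=\coprod_\lambda T(\lambda)$, ordered by: $\mathfrak s\triangleright\mathfrak t$ if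 either $\mathfrak s,\mathfrak t\in T(\lambda)$ for some $\lambda$ and $\mathfrak s\triangleright_\lambda\mathfrak t$, or $\mathfrak s\in T(\lambda)$, $\mathfrak t\in T(\mu)$ and $\lambda>\mu$. Let $A_K=A\otimes_RK\supseteq A$, which is cellular over $K$ with the same basis. A family of JM-elements for $A$ is a set $\{L_1,\dots,L_M\}$ of commuting elements of $A$ with $L_i^*=L_i$, together with scalars $c_{\mathfrak t}(i)\in R$ ($\mathfrak t\in T(\Lambda)$, $1\le i\le M$), such that for all $i$, $\lambda\in\Lambda$ and $\mathfrak s,\mathfrak t\in T(\lambda)$ we have $a^\lambda_{\mathfrak s\mathfrak t}L_i\equiv c_{\mathfrak t}(i)a^\lambda_{\mathfrak s\mathfrak t}+\sum_{\mathfrak v\in T(\lambda),\,\mathfrak v\triangleright\mathfrak t}r_{\mathfrak t\mathfrak v}a^\lambda_{\mathfrak s\mathfrak v}\pmod{A^\lambda}$ for some $r_{\mathfrak t\mathfrak v}\in R$ (depending on $i$). The JM-elements separate $T(\Lambda)$ over $R$ if whenever $\mathfrak s\ne\mathfrak t$ in $T(\Lambda)$ there is $i$ with $c_{\mathfrak s}(i)\ne c_{\mathfrak t}(i)$. Let $\mathscr C(i)=\{c_{\mathfrak t}(i):\mathfrak t\in T(\Lambda)\}$, $F_{\mathfrak t}=\prod_{i=1}^M\prod_{c\in\mathscr C(i),\,c\ne c_{\mathfrak t}(i)}\frac{L_i-c}{c_{\mathfrak t}(i)-c}\in A_K$, and $f^\lambda_{\mathfrak s\mathfrak t}=F_{\mathfrak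 s}a^\lambda_{\mathfrak s\mathfrak t}F_{\mathfrak t}\in A_K$ for $\mathfrak s,\mathfrak t\in T(\lambda)$. *)

theory Defs
  imports
    "HOL-Computational_Algebra.Polynomial_Factorial"
    "HOL-Library.Poly_Mapping"
begin

section \<open>Unital algebras\<close>

text \<open>Algebras are types of sort \<open>{ring, monoid_mult}\<close>, i.e. associative unital rings. The class
  \<open>ring_1\<close> is avoided because its axiom \<open>0 \<noteq> 1\<close> would exclude the zero algebra.\<close>

definition unital_algebra :: "('r::comm_ring_1 \<Rightarrow> 'a::{ring,monoid_mult} \<Rightarrow> 'a) \<Rightarrow> bool" where
  "unital_algebra scale \<longleftrightarrow> module scale \<and>
     (\<forall>r x y. scale r (x * y) = scale r x * y \<and> scale r (x * y) = x * scale r y)"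

text \<open>Product of a finite family of pairwise commuting elements of a possibly noncommutative ring;
  for such families the fold does not depend on the order of the factors.\<close>

definition commuting_prod :: "('i \<Rightarrow> 'a::{ring,monoid_mult}) \<Rightarrow> 'i set \<Rightarrow> 'a" where
  "commuting_prod f I = Finite_Set.fold (\<lambda>i x. f i * x) 1 I"

section \<open>Tensor products and extension of scalars\<close>

text \<open>\<open>('m \<times> 'n) \<Rightarrow>\<^sub>0 int\<close> is the free abelian group on \<open>M \<times> N\<close>. The subgroup generated by the
  bilinear and balancing relations is the one by which it is divided to obtain the tensor product
  of \<open>M\<close> and \<open>N\<close> over \<open>R\<close>.\<close>

inductive_set tensor_relations ::
  "('r::comm_ring_1 \<Rightarrow> 'm::ab_group_add \<Rightarrow> 'm) \<Rightarrow> ('r \<Rightarrow> 'n::ab_group_add \<Rightarrow> 'n) \<Rightarrow>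
   (('m \<times> 'n) \<Rightarrow>\<^sub>0 int) set"
  for sM :: "'r::comm_ring_1 \<Rightarrow> 'm::ab_group_add \<Rightarrow> 'm"
  and sN :: "'r \<Rightarrow> 'n::ab_group_add \<Rightarrow> 'n"
where
  zero: "0 \<in> tensor_relations sM sN"
| diff: "\<lbrakk>x \<in> tensor_relations sM sN; y \<in> tensor_relations sM sN\<rbrakk>
          \<Longrightarrow> x - y \<in> tensor_relations sM sN"
| add_left: "Poly_Mapping.single (m + m', n) 1 - Poly_Mapping.single (m, n) 1
               - Poly_Mapping.single (m', n) 1 \<in> tensor_relations sM sN"
| add_right: "Poly_Mapping.single (m, n + n') 1 - Poly_Mapping.single (m, n) 1
               - Poly_Mapping.single (m, n') 1 \<in> tensor_relations sM sN"
| balanced: "Poly_Mapping.single (sM r m, n) 1 - Poly_Mapping.single (m, sN r n) 1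
               \<in> tensor_relations sM sN"

definition tensor_eval ::
  "('r::comm_ring_1 \<Rightarrow> 'p::ab_group_add \<Rightarrow> 'p) \<Rightarrow> ('m \<Rightarrow> 'n \<Rightarrow> 'p) \<Rightarrow> (('m \<times> 'n) \<Rightarrow>\<^sub>0 int) \<Rightarrow> 'p" where
  "tensor_eval sP \<tau> z =
     (\<Sum>(m, n)\<in>Poly_Mapping.keys z. sP (of_int (Poly_Mapping.lookup z (m, n))) (\<tau> m n))"

text \<open>The \<open>R\<close>-module \<open>P\<close> with \<open>\<tau> m n\<close> in the role of the pure tensors is the tensor product
  of \<open>M\<close> and \<open>N\<close>: the homomorphism from the free abelian group on \<open>M \<times> N\<close> to \<open>P\<close> extending \<open>\<tau>\<close>
  is onto and its kernel is the group of relations. In particular \<open>\<tau>\<close> is bilinear.\<close>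

definition is_tensor_product ::
  "('r::comm_ring_1 \<Rightarrow> 'm::ab_group_add \<Rightarrow> 'm) \<Rightarrow> ('r \<Rightarrow> 'n::ab_group_add \<Rightarrow> 'n) \<Rightarrow>
   ('r \<Rightarrow> 'p::ab_group_add \<Rightarrow> 'p) \<Rightarrow> ('m \<Rightarrow> 'n \<Rightarrow> 'p) \<Rightarrow> bool" where
  "is_tensor_product sM sN sP \<tau> \<longleftrightarrow>
     module sM \<and> module sN \<and> module sP \<and>
     surj (tensor_eval sP \<tau>) \<and>
     {z. tensor_eval sP \<tau> z = 0} = tensor_relations sM sN \<and>
     (\<forall>r m n. sP r (\<tau> m n) = \<tau> (sM r m) n)"

text \<open>The \<open>K\<close>-algebra \<open>B\<close> (with scalar multiplication \<open>sK\<close>) is the tensor product of \<open>A\<close> with the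
  field of fractions \<open>K\<close> of \<open>R\<close>, including its usual \<open>K\<close>-algebra structure.
  The canonical map from \<open>A\<close> to \<open>B\<close> is \<open>\<lambda>x. \<tau> x 1\<close>.\<close>

definition is_scalar_extension ::
  "('r::idom \<Rightarrow> 'a::{ring,monoid_mult} \<Rightarrow> 'a) \<Rightarrow> ('r fract \<Rightarrow> 'b::{ring,monoid_mult} \<Rightarrow> 'b) \<Rightarrow>
   ('a \<Rightarrow> 'r fract \<Rightarrow> 'b) \<Rightarrow> bool" where
  "is_scalar_extension sR sK \<tau> \<longleftrightarrow>
     unital_algebra sK \<and>
     is_tensor_product sR (\<lambda>r k. to_fract r * k) (\<lambda>r. sK (to_fract r)) \<tau> \<and>
     (\<forall>x k l. sK k (\<tau> x l) = \<tau> x (k * l)) \<and>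
     (\<forall>x y k l. \<tau> x k * \<tau> y l = \<tau> (x * y) (k * l)) \<and>
     \<tau> 1 1 = 1"

section \<open>Cellular algebras\<close>

text \<open>\<open>\<Lambda>\<close> is a subset of a type \<open>'l\<close> with strict order \<open>gt\<close> (\<open>gt mu lam\<close> means \<open>mu > lam\<close>), and the
  coproduct of the sets \<open>T lam\<close> is \<open>Sigma \<Lambda> T\<close>.\<close>

definition strict_poset :: "'x set \<Rightarrow> ('x \<Rightarrow> 'x \<Rightarrow> bool) \<Rightarrow> bool" where
  "strict_poset X gt \<longleftrightarrow> irreflp_on X gt \<and> transp_on X gt"

definition cell_index :: "'l set \<Rightarrow> ('l \<Rightarrow> 's set) \<Rightarrow> ('l \<times> 's \<times> 's) set" where
  "cell_index \<Lambda> T = (SIGMA lam:\<Lambda>. T lam \<times> T lam)"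

text \<open>The submodule usually written \<open>A\<^sup>\<lambda>\<close>.\<close>

definition cell_ideal ::
  "('r::comm_ring_1 \<Rightarrow> 'a::{ring,monoid_mult} \<Rightarrow> 'a) \<Rightarrow> 'l set \<Rightarrow> ('l \<Rightarrow> 'l \<Rightarrow> bool) \<Rightarrow> ('l \<Rightarrow> 's set) \<Rightarrow>
   ('l \<Rightarrow> 's \<Rightarrow> 's \<Rightarrow> 'a) \<Rightarrow> 'l \<Rightarrow> 'a set" where
  "cell_ideal scale \<Lambda> gt T C lam =
     module.span scale {C mu y z | mu y z. mu \<in> \<Lambda> \<and> gt mu lam \<and> y \<in> T mu \<and> z \<in> T mu}"

text \<open>The linear map sending \<open>C lam s t\<close> to \<open>C lam t s\<close>; it exists uniquely when the \<open>C lam s t\<close> form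
  a basis.\<close>

definition cell_star ::
  "('r::comm_ring_1 \<Rightarrow> 'a::{ring,monoid_mult} \<Rightarrow> 'a) \<Rightarrow> 'l set \<Rightarrow> ('l \<Rightarrow> 's set) \<Rightarrow>
   ('l \<Rightarrow> 's \<Rightarrow> 's \<Rightarrow> 'a) \<Rightarrow> 'a \<Rightarrow> 'a" where
  "cell_star scale \<Lambda> T C =
     (THE \<phi>. module_hom scale scale \<phi> \<and> (\<forall>lam\<in>\<Lambda>. \<forall>s\<in>T lam. \<forall>t\<in>T lam. \<phi> (C lam s t) = C lam t s))"

definition anti_isomorphism :: "('a::{ring,monoid_mult} \<Rightarrow> 'a) \<Rightarrow> bool" where
  "anti_isomorphism \<phi> \<longleftrightarrow> bij \<phi> \<and> \<phi> 1 = 1 \<and>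
     (\<forall>x y. \<phi> (x + y) = \<phi> x + \<phi> y) \<and> (\<forall>x y. \<phi> (x * y) = \<phi> y * \<phi> x)"

text \<open>\<open>(\<Lambda>, T, C)\<close> is a cell datum for the algebra, equivalently the family \<open>C lam s t\<close> is a cellular
  basis. The injectivity condition on \<open>C\<close> makes it legitimate to treat the basis as a set.\<close>

definition cell_datum ::
  "('r::comm_ring_1 \<Rightarrow> 'a::{ring,monoid_mult} \<Rightarrow> 'a) \<Rightarrow> 'l set \<Rightarrow> ('l \<Rightarrow> 'l \<Rightarrow> bool) \<Rightarrow> ('l \<Rightarrow> 's set) \<Rightarrow>
   ('l \<Rightarrow> 's \<Rightarrow> 's \<Rightarrow> 'a) \<Rightarrow> bool" where
  "cell_datum scale \<Lambda> gt T C \<longleftrightarrow>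
     unital_algebra scale \<and>
     finite \<Lambda> \<and> strict_poset \<Lambda> gt \<and> (\<forall>lam\<in>\<Lambda>. finite (T lam)) \<and>
     inj_on (\<lambda>(lam, s, t). C lam s t) (cell_index \<Lambda> T) \<and>
     \<not> module.dependent scale ((\<lambda>(lam, s, t). C lam s t) ` cell_index \<Lambda> T) \<and>
     module.span scale ((\<lambda>(lam, s, t). C lam s t) ` cell_index \<Lambda> T) = UNIV \<and>
     (\<forall>x. \<forall>lam\<in>\<Lambda>. \<forall>t\<in>T lam. \<exists>r :: 's \<Rightarrow> 'r. \<forall>s\<in>T lam.
        C lam s t * x - (\<Sum>v\<in>T lam. scale (r v) (C lam s v)) \<in> cell_ideal scale \<Lambda> gt T C lam) \<and>
     anti_isomorphism (cell_star scale \<Lambda> T C)"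

section \<open>JM-elements\<close>

text \<open>The order on \<open>Sigma \<Lambda> T\<close>; \<open>tgt lam\<close> is the given strict order on \<open>T lam\<close>.\<close>

definition tab_gt ::
  "('l \<Rightarrow> 'l \<Rightarrow> bool) \<Rightarrow> ('l \<Rightarrow> 's \<Rightarrow> 's \<Rightarrow> bool) \<Rightarrow> 'l \<times> 's \<Rightarrow> 'l \<times> 's \<Rightarrow> bool" where
  "tab_gt gt tgt p q \<longleftrightarrow>
     (fst p = fst q \<and> tgt (fst p) (snd p) (snd q)) \<or> gt (fst p) (fst q)"

definition JM_family ::
  "('r::comm_ring_1 \<Rightarrow> 'a::{ring,monoid_mult} \<Rightarrow> 'a) \<Rightarrow> 'l set \<Rightarrow> ('l \<Rightarrow> 'l \<Rightarrow> bool) \<Rightarrow> ('l \<Rightarrow> 's set) \<Rightarrow>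
   ('l \<Rightarrow> 's \<Rightarrow> 's \<Rightarrow> 'a) \<Rightarrow> ('l \<Rightarrow> 's \<Rightarrow> 's \<Rightarrow> bool) \<Rightarrow>
   nat \<Rightarrow> (nat \<Rightarrow> 'a) \<Rightarrow> ('l \<times> 's \<Rightarrow> nat \<Rightarrow> 'r) \<Rightarrow> bool" where
  "JM_family scale \<Lambda> gt T C tgt M L c \<longleftrightarrow>
     (\<forall>i\<in>{1..M}. \<forall>j\<in>{1..M}. L i * L j = L j * L i) \<and>
     (\<forall>i\<in>{1..M}. cell_star scale \<Lambda> T C (L i) = L i) \<and>
     (\<forall>i\<in>{1..M}. \<forall>lam\<in>\<Lambda>. \<forall>t\<in>T lam. \<exists>r :: 's \<Rightarrow> 'r. \<forall>s\<in>T lam.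
        C lam s t * L i
          - (scale (c (lam, t) i) (C lam s t)
             + (\<Sum>v\<in>{v \<in> T lam. tab_gt gt tgt (lam, v) (lam, t)}. scale (r v) (C lam s v)))
        \<in> cell_ideal scale \<Lambda> gt T C lam)"

definition JM_separate ::
  "'l set \<Rightarrow> ('l \<Rightarrow> 's set) \<Rightarrow> nat \<Rightarrow> ('l \<times> 's \<Rightarrow> nat \<Rightarrow> 'r) \<Rightarrow> bool" where
  "JM_separate \<Lambda> T M c \<longleftrightarrow>
     (\<forall>p\<in>Sigma \<Lambda> T. \<forall>q\<in>Sigma \<Lambda> T. p \<noteq> q \<longrightarrow> (\<exists>i\<in>{1..M}. c p i \<noteq> c q i))"

definition contents ::
  "'l set \<Rightarrow> ('l \<Rightarrow> 's set) \<Rightarrow> ('l \<times> 's \<Rightarrow> nat \<Rightarrow> 'r) \<Rightarrow> nat \<Rightarrow> 'r set" where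
  "contents \<Lambda> T c i = (\<lambda>p. c p i) ` Sigma \<Lambda> T"

section \<open>The elements \<open>F\<close> and \<open>f\<close> of the scalar extension\<close>

definition F_elt ::
  "('r::idom fract \<Rightarrow> 'b::{ring,monoid_mult} \<Rightarrow> 'b) \<Rightarrow> ('a \<Rightarrow> 'r fract \<Rightarrow> 'b) \<Rightarrow>
   'l set \<Rightarrow> ('l \<Rightarrow> 's set) \<Rightarrow> nat \<Rightarrow> (nat \<Rightarrow> 'a) \<Rightarrow> ('l \<times> 's \<Rightarrow> nat \<Rightarrow> 'r) \<Rightarrow> 'l \<times> 's \<Rightarrow> 'b" where
  "F_elt sK \<tau> \<Lambda> T M L c p =
     commuting_prod (\<lambda>i.
       commuting_prod (\<lambda>d.
         sK (inverse (to_fract (c p i) - to_fract d)) (\<tau> (L i) 1 - sK (to_fract d) 1))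
       {d \<in> contents \<Lambda> T c i. d \<noteq> c p i})
     {1..M}"

definition f_elt ::
  "('r::idom fract \<Rightarrow> 'b::{ring,monoid_mult} \<Rightarrow> 'b) \<Rightarrow> ('a \<Rightarrow> 'r fract \<Rightarrow> 'b) \<Rightarrow>
   'l set \<Rightarrow> ('l \<Rightarrow> 's set) \<Rightarrow> ('l \<Rightarrow> 's \<Rightarrow> 's \<Rightarrow> 'a) \<Rightarrow>
   nat \<Rightarrow> (nat \<Rightarrow> 'a) \<Rightarrow> ('l \<times> 's \<Rightarrow> nat \<Rightarrow> 'r) \<Rightarrow> 'l \<Rightarrow> 's \<Rightarrow> 's \<Rightarrow> 'b" where
  "f_elt sK \<tau> \<Lambda> T C M L c lam s t =
     F_elt sK \<tau> \<Lambda> T M L c (lam, s) * \<tau> (C lam s t) 1 * F_elt sK \<tau> \<Lambda> T M L c (lam, t)"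

end

theory Submission
  imports Defs
begin

text \<open>
  Over \<open>K\<close>, right multiplication by the \<open>L i\<close> is triangular with respect
  to the cellular basis and the order on \<open>Sigma \<Lambda> T\<close>, and the diagonal entries at
  \<open>C lam s t\<close> are the contents of \<open>(lam, t)\<close>. Triangularity alone does not make commuting operators
  diagonalisable, because each list of contents occurs once for every \<open>s\<close>. Separation does help: the
  basis elements that may occur in \<open>C lam s t * L i - c (lam, t) i C lam s t\<close> belong to strictly
  larger \<open>(mu, z)\<close>, whose contents differ from those of \<open>(lam, t)\<close>. Since \<open>F (lam, t)\<close> is an
  interpolation polynomial in the \<open>L i\<close> that is 1 at the contents of \<open>(lam, t)\<close> and 0 at all others,
  induction down the order shows at once that it annihilates these larger elements and that
  \<open>g lam s t = C lam s t * F (lam, t)\<close> is a simultaneous eigenvector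
  (lemma \<open>g_eigenvector_and_C_F_zero\<close>).

  The \<open>g lam s t\<close> span the algebra, so identities between the \<open>F p\<close> can be tested on them: the \<open>F p\<close>
  are orthogonal idempotents with sum 1 (\<open>F_orthogonal\<close>, \<open>sum_F\<close>), and they are fixed by the
  anti-involution. For \<open>f lam s t = F (lam, s) * C lam s t * F (lam, t)\<close> this gives the vanishing
  products at once. It also shows that the \<open>f lam s t\<close> span, hence are a basis, by splitting
  \<open>g lam s t\<close> with the decomposition of 1 on the left (\<open>span_fbasis\<close>).

  That \<open>f lam s t * f lam t v\<close> is a multiple of \<open>f lam s v\<close> follows because right multiplication by
  \<open>F (lam, v)\<close> maps each \<open>C lam s w\<close> into the line of \<open>g lam s v\<close>. The factor does not depend on \<open>s\<close> by
  the cellular multiplication rule (\<open>f_mult_left_uniform\<close>), and then does not depend on \<open>v\<close> because the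
  anti-involution exchanges the roles of \<open>s\<close> and \<open>v\<close> (\<open>f_mult\<close>). The multiplication rule in turn
  makes the \<open>f lam s t\<close> a cellular basis (\<open>f_cell_datum\<close>).

  To work over \<open>K\<close> the cellular structure has to be moved from \<open>A\<close> to \<open>A \<otimes> K\<close>. The images of the basis
  elements span, and they are independent because the universal property of the tensor product
  extends every coordinate functional \<open>A \<rightarrow> R\<close> to a linear functional \<open>A \<otimes> K \<rightarrow> K\<close>
  (\<open>coordinate_functional\<close>). The remaining axioms are linear in the element of \<open>A \<otimes> K\<close> concerned and so
  need to be checked only on the image of \<open>A\<close>.
\<close>

section \<open>Free modules and cellular bases\<close>

lemma free_module_hom_exists:
  assumes "module s1" "module s2" "finite B"
    and indep: "\<not> module.dependent s1 B" and span: "module.span s1 B = UNIV"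
  obtains \<phi> where "module_hom s1 s2 \<phi>" "\<And>b. b \<in> B \<Longrightarrow> \<phi> b = f b"
proof -
  interpret m1: module s1 by fact
  interpret m2: module s2 by fact
  define \<phi> where "\<phi> x = (\<Sum>b\<in>B. s2 (m1.representation B x b) (f b))" for x
  have "module_hom s1 s2 \<phi>"
    by unfold_locales
      (simp_all add: \<phi>_def indep span m1.representation_add m1.representation_scale
        m2.scale_left_distrib sum.distrib m2.scale_sum_right)
  moreover have "\<phi> b = f b" if "b \<in> B" for b
  proof -
    have "\<phi> b = (\<Sum>b'\<in>B. if b' = b then f b else 0)"
      unfolding \<phi>_def m1.representation_basis[OF indep that]
      by (intro sum.cong) auto
    then show ?thesis using that \<open>finite B\<close> by simp
  qed
  ultimately show thesis by (rule that)
qed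

text \<open>The description of \<open>cell_star\<close> determines at most one map, since a linear map is fixed by its values
  on a spanning family; existence comes from freeness, in lemma \<open>star_hom\<close> below.\<close>

lemma cell_star_eqI:
  assumes hom: "module_hom scale scale \<phi>"
    and swap: "\<And>lam s t. \<lbrakk>lam \<in> \<Lambda>; s \<in> T lam; t \<in> T lam\<rbrakk> \<Longrightarrow> \<phi> (C lam s t) = C lam t s"
    and span: "module.span scale ((\<lambda>(lam, s, t). C lam s t) ` cell_index \<Lambda> T) = UNIV"
  shows "cell_star scale \<Lambda> T C = \<phi>"
  unfolding cell_star_def
proof (rule the_equality)
  interpret p: module_hom scale scale \<phi> by fact
  show "module_hom scale scale \<phi> \<and> (\<forall>lam\<in>\<Lambda>. \<forall>s\<in>T lam. \<forall>t\<in>T lam. \<phi> (C lam s t) = C lam t s)"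
    using hom swap by blast
  fix \<psi> assume \<psi>: "module_hom scale scale \<psi> \<and>
    (\<forall>lam\<in>\<Lambda>. \<forall>s\<in>T lam. \<forall>t\<in>T lam. \<psi> (C lam s t) = C lam t s)"
  interpret q: module_hom scale scale \<psi> using \<psi> by blast
  show "\<psi> = \<phi>"
  proof
    fix x
    have "x \<in> module.span scale ((\<lambda>(lam, s, t). C lam s t) ` cell_index \<Lambda> T)"
      using span by simp
    then show "\<psi> x = \<phi> x"
      by (induction rule: p.m1.span_induct_alt)
        (use \<psi> swap in \<open>auto simp: cell_index_def p.add p.scale q.add q.scale\<close>)
  qed
qed

lemma JM_family_action:
  assumes "JM_family scale \<Lambda> gt T C tgt M L c" "i \<in> {1..M}" "lam \<in> \<Lambda>" "t \<in> T lam"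
  shows "\<exists>r. \<forall>s\<in>T lam. C lam s t * L i - (scale (c (lam, t) i) (C lam s t)
    + (\<Sum>v\<in>{v \<in> T lam. tab_gt gt tgt (lam, v) (lam, t)}. scale (r v) (C lam s v)))
    \<in> cell_ideal scale \<Lambda> gt T C lam"
  by (rule bspec[OF bspec[OF bspec[OF assms(1)[unfolded JM_family_def, THEN conjunct2, THEN conjunct2]
          assms(2)] assms(3)] assms(4)])

locale cell_algebra =
  fixes scale :: "'r::comm_ring_1 \<Rightarrow> 'a::{ring,monoid_mult} \<Rightarrow> 'a"
    and \<Lambda> :: "'l set" and gt :: "'l \<Rightarrow> 'l \<Rightarrow> bool"
    and T :: "'l \<Rightarrow> 's set" and C :: "'l \<Rightarrow> 's \<Rightarrow> 's \<Rightarrow> 'a"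
  assumes cellular: "cell_datum scale \<Lambda> gt T C"
begin

sublocale module scale
  using cellular by (simp add: cell_datum_def unital_algebra_def)

lemma scale_mult_left: "scale r x * y = scale r (x * y)"
  and scale_mult_right: "x * scale r y = scale r (x * y)"
  using cellular unfolding cell_datum_def unital_algebra_def by metis+

definition basis :: "'a set" where
  "basis = (\<lambda>(lam, s, t). C lam s t) ` cell_index \<Lambda> T"

abbreviation star :: "'a \<Rightarrow> 'a" where
  "star \<equiv> cell_star scale \<Lambda> T C"

abbreviation ideal :: "'l \<Rightarrow> 'a set" where
  "ideal \<equiv> cell_ideal scale \<Lambda> gt T C"

lemma finite_poset: "finite \<Lambda>"
  and finite_T: "lam \<in> \<Lambda> \<Longrightarrow> finite (T lam)"
  and strict_poset: "strict_poset \<Lambda> gt"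
  and inj_C: "inj_on (\<lambda>(lam, s, t). C lam s t) (cell_index \<Lambda> T)"
  and independent_basis: "independent basis"
  and span_basis: "span basis = UNIV"
  using cellular by (simp_all add: cell_datum_def basis_def)

lemma cell_action:
  assumes "lam \<in> \<Lambda>" "t \<in> T lam"
  obtains r where
    "\<And>s. s \<in> T lam \<Longrightarrow> C lam s t * x - (\<Sum>v\<in>T lam. scale (r v) (C lam s v)) \<in> ideal lam"
  using cellular assms unfolding cell_datum_def by meson

lemma finite_index: "finite (cell_index \<Lambda> T)"
  unfolding cell_index_def using finite_poset finite_T by blast

lemma finite_basis: "finite basis"
  by (simp add: basis_def finite_index)

lemma basisI: "\<lbrakk>lam \<in> \<Lambda>; s \<in> T lam; t \<in> T lam\<rbrakk> \<Longrightarrow> C lam s t \<in> basis"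
  by (force simp: basis_def cell_index_def)

lemma C_eq_iff:
  assumes "lam \<in> \<Lambda>" "s \<in> T lam" "t \<in> T lam" "mu \<in> \<Lambda>" "u \<in> T mu" "v \<in> T mu"
  shows "C lam s t = C mu u v \<longleftrightarrow> lam = mu \<and> s = u \<and> t = v"
  using inj_onD[OF inj_C, of "(lam, s, t)" "(mu, u, v)"] assms by (auto simp: cell_index_def)

lemma basis_induct [case_names zero step]:
  assumes "P 0"
    and "\<And>r lam s t x. \<lbrakk>lam \<in> \<Lambda>; s \<in> T lam; t \<in> T lam; P x\<rbrakk> \<Longrightarrow> P (scale r (C lam s t) + x)"
  shows "P x"
proof -
  have "x \<in> span basis" by (simp add: span_basis)
  then show ?thesis
    by (induction rule: span_induct_alt) (use assms in \<open>auto simp: basis_def cell_index_def\<close>)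
qed

lemma star_hom: "module_hom scale scale star"
  and star_C: "\<lbrakk>lam \<in> \<Lambda>; s \<in> T lam; t \<in> T lam\<rbrakk> \<Longrightarrow> star (C lam s t) = C lam t s"
proof -
  define i where "i = the_inv_into (cell_index \<Lambda> T) (\<lambda>(lam, s, t). C lam s t)"
  have i: "i (C lam s t) = (lam, s, t)" if "lam \<in> \<Lambda>" "s \<in> T lam" "t \<in> T lam" for lam s t
    using the_inv_into_f_f[OF inj_C, of "(lam, s, t)"] that
    by (simp add: i_def cell_index_def)
  obtain \<phi> where hom: "module_hom scale scale \<phi>"
    and \<phi>: "\<And>b. b \<in> basis \<Longrightarrow> \<phi> b = (case i b of (lam, s, t) \<Rightarrow> C lam t s)"
    using free_module_hom_exists[OF module_axioms module_axioms finite_basis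
        independent_basis span_basis, where f = "\<lambda>b. case i b of (lam, s, t) \<Rightarrow> C lam t s"] by blast
  have swap: "\<phi> (C lam s t) = C lam t s" if "lam \<in> \<Lambda>" "s \<in> T lam" "t \<in> T lam" for lam s t
    using \<phi>[OF basisI[OF that]] i[OF that] by simp
  have "star = \<phi>"
    by (rule cell_star_eqI[OF hom swap]) (use span_basis in \<open>simp_all add: basis_def\<close>)
  then show "module_hom scale scale star"
    and "\<lbrakk>lam \<in> \<Lambda>; s \<in> T lam; t \<in> T lam\<rbrakk> \<Longrightarrow> star (C lam s t) = C lam t s"
    using hom swap by auto
qed

sublocale star: module_hom scale scale star
  by (rule star_hom)

lemma star_mult: "star (x * y) = star y * star x"
  and star_one: "star 1 = 1"
  using cellular by (simp_all add: cell_datum_def anti_isomorphism_def)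

lemma star_star: "star (star x) = x"
  by (induction x rule: basis_induct) (simp_all add: star.add star.scale star_C)

lemma gt_irrefl: "lam \<in> \<Lambda> \<Longrightarrow> \<not> gt lam lam"
  using strict_poset by (auto simp: strict_poset_def irreflp_on_def)

lemma gt_trans: "\<lbrakk>gt x y; gt y z; x \<in> \<Lambda>; y \<in> \<Lambda>; z \<in> \<Lambda>\<rbrakk> \<Longrightarrow> gt x z"
  using strict_poset by (auto simp: strict_poset_def dest: transp_onD)

lemma subspace_ideal: "subspace (ideal lam)"
  by (simp add: cell_ideal_def)

lemma C_in_ideal: "\<lbrakk>mu \<in> \<Lambda>; gt mu lam; y \<in> T mu; z \<in> T mu\<rbrakk> \<Longrightarrow> C mu y z \<in> ideal lam"
  unfolding cell_ideal_def by (rule span_base) blast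

lemma ideal_minimal:
  assumes "subspace S"
    and "\<And>mu y z. \<lbrakk>mu \<in> \<Lambda>; gt mu lam; y \<in> T mu; z \<in> T mu\<rbrakk> \<Longrightarrow> C mu y z \<in> S"
  shows "ideal lam \<subseteq> S"
  unfolding cell_ideal_def by (rule span_minimal) (use assms in auto)

lemma star_ideal:
  assumes "x \<in> ideal lam"
  shows "star x \<in> ideal lam"
proof -
  have "subspace {x. star x \<in> ideal lam}"
    by (rule subspaceI)
      (simp_all add: star.add star.scale subspace_0 subspace_add subspace_scale subspace_ideal)
  then have "ideal lam \<subseteq> {x. star x \<in> ideal lam}"
    by (rule ideal_minimal) (simp add: star_C C_in_ideal)
  with assms show ?thesis by blast
qed

lemma ideal_mono: "\<lbrakk>gt mu lam; mu \<in> \<Lambda>; lam \<in> \<Lambda>\<rbrakk> \<Longrightarrow> ideal mu \<subseteq> ideal lam"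
  unfolding cell_ideal_def using gt_trans by (intro span_mono) blast

text \<open>Multiplying a basis element with index \<open>mu\<close> on the right gives elements with index \<open>mu\<close>, up to
  elements of even larger index. By \<open>star_ideal\<close> the submodule is then a left ideal as well.\<close>

lemma ideal_mult_right:
  assumes "lam \<in> \<Lambda>" "x \<in> ideal lam"
  shows "x * a \<in> ideal lam"
  using assms(2) unfolding cell_ideal_def
proof (induction rule: span_induct_alt)
  case base
  then show ?case by (simp add: span_zero)
next
  case (step r b y)
  then obtain mu s t where b: "b = C mu s t" and mu: "mu \<in> \<Lambda>" "gt mu lam" "s \<in> T mu" "t \<in> T mu"
    by blast
  obtain q where "C mu s t * a - (\<Sum>v\<in>T mu. scale (q v) (C mu s v)) \<in> ideal mu"
    using cell_action[OF mu(1,4)] mu(3) by metis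
  moreover have "(\<Sum>v\<in>T mu. scale (q v) (C mu s v)) \<in> ideal lam"
    using mu by (intro subspace_sum subspace_scale subspace_ideal C_in_ideal)
  ultimately have "C mu s t * a - (\<Sum>v\<in>T mu. scale (q v) (C mu s v))
      + (\<Sum>v\<in>T mu. scale (q v) (C mu s v)) \<in> ideal lam"
    using ideal_mono[OF mu(2,1) assms(1)] by (intro subspace_add[OF subspace_ideal]) auto
  then have "b * a \<in> ideal lam"
    by (simp add: b)
  then show ?case
    using step by (simp add: distrib_right scale_mult_left span_add span_scale cell_ideal_def)
qed

end

section \<open>Tensor products and scalar extension\<close>

lemma tensor_eval_diff:
  assumes "module sP"
  shows "tensor_eval sP \<tau> (x - y) = tensor_eval sP \<tau> x - tensor_eval sP \<tau> y"
proof -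
  interpret module sP by fact
  have ev: "tensor_eval sP \<tau> z =
      (\<Sum>(m, n)\<in>Poly_Mapping.keys x \<union> Poly_Mapping.keys y. sP (of_int (Poly_Mapping.lookup z (m, n))) (\<tau> m n))"
    if "Poly_Mapping.keys z \<subseteq> Poly_Mapping.keys x \<union> Poly_Mapping.keys y" for z
    unfolding tensor_eval_def
    by (rule sum.mono_neutral_left) (use that in \<open>auto simp: in_keys_iff\<close>)
  show ?thesis
    by (subst (1 2 3) ev)
      (use keys_diff[of x y] in
        \<open>auto simp: lookup_minus scale_left_diff_distrib sum_subtractf[symmetric] intro!: sum.cong\<close>)
qed

lemma tensor_eval_single:
  assumes "module sP"
  shows "tensor_eval sP \<tau> (Poly_Mapping.single (m, n) 1) = \<tau> m n"
proof -
  interpret module sP by fact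
  show ?thesis by (simp add: tensor_eval_def)
qed

lemma tensor_eval_relations:
  assumes "module sP"
    and "\<And>m m' n. h (m + m') n = h m n + h m' n" "\<And>m n n'. h m (n + n') = h m n + h m n'"
    and "\<And>r m n. h (sM r m) n = h m (sN r n)"
    and "z \<in> tensor_relations sM sN"
  shows "tensor_eval sP h z = 0"
  using assms(5)
proof induction
  case zero
  then show ?case by (simp add: tensor_eval_def)
qed (simp_all add: assms(1-4) tensor_eval_diff tensor_eval_single)

lemma tensor_bilinear:
  assumes "is_tensor_product sM sN sP \<tau>"
  shows "\<tau> (m + m') n = \<tau> m n + \<tau> m' n" "\<tau> m (n + n') = \<tau> m n + \<tau> m n'"
proof -
  have P: "module sP" and ker: "\<And>z. z \<in> tensor_relations sM sN \<Longrightarrow> tensor_eval sP \<tau> z = 0"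
    using assms by (auto simp: is_tensor_product_def)
  show "\<tau> (m + m') n = \<tau> m n + \<tau> m' n"
  proof -
    have "\<tau> (m + m') n - \<tau> m n - \<tau> m' n = 0"
      using ker[OF tensor_relations.add_left[of m m' n]]
      by (simp only: tensor_eval_diff[OF P] tensor_eval_single[OF P])
    then show ?thesis by (simp add: algebra_simps)
  qed
  show "\<tau> m (n + n') = \<tau> m n + \<tau> m n'"
  proof -
    have "\<tau> m (n + n') - \<tau> m n - \<tau> m n' = 0"
      using ker[OF tensor_relations.add_right[of m n n']]
      by (simp only: tensor_eval_diff[OF P] tensor_eval_single[OF P])
    then show ?thesis by (simp add: algebra_simps)
  qed
qed

lemma tensor_spanned:
  assumes "is_tensor_product sM sN sP \<tau>" and "\<And>m n. \<tau> m n \<in> S" and "module.subspace sP S"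
  shows "x \<in> S"
proof -
  interpret P: module sP using assms by (simp add: is_tensor_product_def)
  obtain z where "x = tensor_eval sP \<tau> z"
    using assms unfolding is_tensor_product_def by (metis surjD)
  then show ?thesis
    unfolding tensor_eval_def using assms
    by (auto intro!: P.subspace_sum P.subspace_scale)
qed

text \<open>A balanced biadditive map vanishes on the relations, which are exactly the kernel of evaluation,
  so it factors through the tensor product. Additivity is stated with differences because the
  subgroup of relations is generated with them.\<close>

lemma tensor_universal:
  fixes sQ :: "'r::comm_ring_1 \<Rightarrow> 'q::ab_group_add \<Rightarrow> 'q" and h :: "'m::ab_group_add \<Rightarrow> 'n::ab_group_add \<Rightarrow> 'q"
  assumes tp: "is_tensor_product sM sN sP \<tau>" and Q: "module sQ"
    and h: "\<And>m m' n. h (m + m') n = h m n + h m' n" "\<And>m n n'. h m (n + n') = h m n + h m n'"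
      "\<And>r m n. h (sM r m) n = h m (sN r n)"
  obtains \<phi> where "\<And>x y. \<phi> (x - y) = \<phi> x - \<phi> y" "\<And>m n. \<phi> (\<tau> m n) = h m n"
proof -
  have P: "module sP" and surj: "surj (tensor_eval sP \<tau>)"
    and ker: "\<And>z. tensor_eval sP \<tau> z = 0 \<Longrightarrow> z \<in> tensor_relations sM sN"
    using tp by (auto simp: is_tensor_product_def)
  define \<phi> where "\<phi> x = tensor_eval sQ h (inv (tensor_eval sP \<tau>) x)" for x
  have \<phi>: "\<phi> (tensor_eval sP \<tau> z) = tensor_eval sQ h z" for z
  proof -
    let ?z = "inv (tensor_eval sP \<tau>) (tensor_eval sP \<tau> z)"
    have "tensor_eval sP \<tau> (?z - z) = 0"
      by (simp add: P tensor_eval_diff surj_f_inv_f[OF surj])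
    then have "tensor_eval sQ h (?z - z) = 0"
      using tensor_eval_relations[of sQ h sM sN] Q h ker by blast
    then show ?thesis by (simp add: \<phi>_def Q tensor_eval_diff)
  qed
  have "\<phi> (x - y) = \<phi> x - \<phi> y" for x y
  proof -
    obtain z w where "x = tensor_eval sP \<tau> z" "y = tensor_eval sP \<tau> w"
      using surj by (metis surjD)
    then show ?thesis
      by (metis P Q \<phi> tensor_eval_diff)
  qed
  moreover have "\<phi> (\<tau> m n) = h m n" for m n
    using \<phi>[of "Poly_Mapping.single (m, n) 1"] by (simp add: P Q tensor_eval_single)
  ultimately show thesis by (rule that)
qed

text \<open>The map \<open>\<iota>\<close> below is the canonical map from \<open>A\<close> to \<open>A \<otimes> K\<close>. It is semilinear along \<open>R \<rightarrow> K\<close>, not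
  linear over one ring, which is why its compatibility with the operations is recorded separately.\<close>

locale scalar_extension = cell_algebra sR \<Lambda> gt T C
  for sR :: "'r::idom \<Rightarrow> 'a::{ring,monoid_mult} \<Rightarrow> 'a"
    and \<Lambda> :: "'l set" and gt :: "'l \<Rightarrow> 'l \<Rightarrow> bool"
    and T :: "'l \<Rightarrow> 's set" and C :: "'l \<Rightarrow> 's \<Rightarrow> 's \<Rightarrow> 'a" +
  fixes sK :: "'r fract \<Rightarrow> 'b::{ring,monoid_mult} \<Rightarrow> 'b"
    and \<tau> :: "'a \<Rightarrow> 'r fract \<Rightarrow> 'b"
  assumes extension: "is_scalar_extension sR sK \<tau>"
begin

sublocale K: vector_space sK
  using extension by (simp add: is_scalar_extension_def unital_algebra_def module_iff_vector_space)

definition \<iota> :: "'a \<Rightarrow> 'b" where "\<iota> x = \<tau> x 1"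

definition Kbasis :: "'b set" where
  "Kbasis = (\<lambda>(lam, s, t). \<iota> (C lam s t)) ` cell_index \<Lambda> T"

lemma sK_mult_left: "sK r x * y = sK r (x * y)"
  and sK_mult_right: "x * sK r y = sK r (x * y)"
  using extension unfolding is_scalar_extension_def unital_algebra_def by metis+

lemma tensor: "is_tensor_product sR (\<lambda>r k. to_fract r * k) (\<lambda>r. sK (to_fract r)) \<tau>"
  using extension by (simp add: is_scalar_extension_def)

lemma \<tau>_conv: "\<tau> x k = sK k (\<iota> x)"
  using extension unfolding is_scalar_extension_def \<iota>_def by (metis mult.right_neutral)

lemma \<iota>_mult: "\<iota> (x * y) = \<iota> x * \<iota> y"
  using extension unfolding is_scalar_extension_def \<iota>_def by (metis mult.right_neutral)

lemma \<iota>_one: "\<iota> 1 = 1"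
  using extension unfolding is_scalar_extension_def \<iota>_def by blast

lemma \<iota>_add: "\<iota> (x + y) = \<iota> x + \<iota> y"
  by (simp add: \<iota>_def tensor_bilinear[OF tensor])

lemma \<iota>_scale: "\<iota> (sR r x) = sK (to_fract r) (\<iota> x)"
  using tensor unfolding is_tensor_product_def \<iota>_def by simp

lemma \<iota>_diff: "\<iota> (x - y) = \<iota> x - \<iota> y"
  by (metis \<iota>_add add_diff_cancel diff_add_cancel)

lemma \<iota>_zero: "\<iota> 0 = 0"
  using \<iota>_diff[of 0 0] by simp

lemma \<iota>_sum: "\<iota> (sum f I) = (\<Sum>i\<in>I. \<iota> (f i))"
  by (induction I rule: infinite_finite_induct) (simp_all add: \<iota>_add \<iota>_zero)

text \<open>Every pure tensor \<open>\<tau> x k\<close> is \<open>k\<close> times \<open>\<iota> x\<close>. A property that defines a \<open>K\<close>-subspace can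
  therefore be verified on the image of \<open>A\<close> alone; this is how the axioms of a cell datum are
  transferred.\<close>

lemma K_spanned:
  assumes "K.subspace S" and "\<And>a. \<iota> a \<in> S"
  shows "x \<in> S"
proof (rule tensor_spanned[OF tensor])
  show "\<tau> m n \<in> S" for m n
    using assms by (simp add: \<tau>_conv K.subspace_scale)
  have m: "module (\<lambda>r. sK (to_fract r))"
    using tensor by (simp add: is_tensor_product_def)
  show "module.subspace (\<lambda>r. sK (to_fract r)) S"
    by (rule module.subspaceI[OF m])
      (simp_all add: assms(1) K.subspace_0 K.subspace_add K.subspace_scale)
qed

lemma \<iota>_in_span_Kbasis: "\<iota> a \<in> K.span Kbasis"
proof (induction a rule: basis_induct)
  case zero
  then show ?case by (simp add: \<iota>_zero K.span_zero)
next
  case (step r lam s t x)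
  then have "\<iota> (C lam s t) \<in> Kbasis" by (force simp: Kbasis_def cell_index_def)
  with step show ?case
    by (simp add: \<iota>_add \<iota>_scale K.span_add K.span_scale K.span_base)
qed

lemma span_Kbasis: "K.span Kbasis = UNIV"
  using K_spanned[OF K.subspace_span] \<iota>_in_span_Kbasis by blast

text \<open>The coordinate \<open>p\<close> belonging to \<open>b\<close> is an \<open>R\<close>-linear map \<open>A \<rightarrow> R\<close>; the functional sought is induced
  by the balanced map \<open>(m, k) \<mapsto> p m * k\<close>. These functionals separate the images of the basis
  elements, so these images are distinct and independent.\<close>

lemma coordinate_functional:
  assumes "b \<in> basis"
  shows "\<exists>\<phi>. module_hom sK (*) \<phi> \<and> (\<forall>b'\<in>basis. \<phi> (\<iota> b') = (if b' = b then 1 else 0))"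
proof -
  have m: "module ((*) :: 'r \<Rightarrow> 'r \<Rightarrow> 'r)"
    and mK: "module ((*) :: 'r fract \<Rightarrow> 'r fract \<Rightarrow> 'r fract)"
    and mRK: "module (\<lambda>(r :: 'r) k. to_fract r * k)"
    by unfold_locales (auto simp: algebra_simps)
  obtain p where p: "module_hom sR (*) p" and pb: "\<And>b'. b' \<in> basis \<Longrightarrow> p b' = (if b' = b then 1 else 0)"
    using free_module_hom_exists[OF module_axioms m finite_basis independent_basis span_basis,
          where f = "\<lambda>b'. if b' = b then 1 else 0"] by blast
  interpret p: module_hom sR "(*)" p by fact
  obtain \<phi> where \<phi>_diff: "\<And>x y. \<phi> (x - y) = \<phi> x - \<phi> y"
    and \<phi>: "\<And>m n. \<phi> (\<tau> m n) = to_fract (p m) * n"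
    using tensor_universal[OF tensor mRK, of "\<lambda>m n. to_fract (p m) * n"]
    by (auto simp: p.add p.scale algebra_simps)
  have \<phi>_zero: "\<phi> 0 = 0" using \<phi>_diff[of 0 0] by simp
  have \<phi>_add: "\<phi> (x + y) = \<phi> x + \<phi> y" for x y
    using \<phi>_diff[of "x + y" y] by (simp add: algebra_simps)
  let ?S = "{x. \<forall>k. \<phi> (sK k x) = k * \<phi> x}"
  have "K.subspace ?S"
    by (rule K.subspaceI)
      (simp_all add: \<phi>_zero \<phi>_add K.scale_right_distrib distrib_left mult.assoc)
  moreover have "\<iota> a \<in> ?S" for a
    using \<phi>[of a] \<phi>[of a 1] by (simp add: \<tau>_conv mult.commute)
  ultimately have "\<forall>k. \<phi> (sK k x) = k * \<phi> x" for x
    using K_spanned[of ?S] by blast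
  then have "module_hom sK (*) \<phi>"
    using mK K.module_axioms by (auto simp: module_hom_def module_hom_axioms_def \<phi>_add)
  moreover have "\<phi> (\<iota> b') = (if b' = b then 1 else 0)" if "b' \<in> basis" for b'
    using \<phi>[of b' 1] pb[OF that] by (simp add: \<iota>_def)
  ultimately show ?thesis by blast
qed

lemma Kbasis_conv: "Kbasis = \<iota> ` basis"
  by (simp add: Kbasis_def basis_def image_image case_prod_unfold)

lemma inj_on_\<iota>_basis: "inj_on \<iota> basis"
proof
  fix b b' assume b: "b \<in> basis" "b' \<in> basis" and eq: "\<iota> b = \<iota> b'"
  obtain \<phi> where "module_hom sK (*) \<phi>"
    and \<phi>: "\<forall>b'\<in>basis. \<phi> (\<iota> b') = (if b' = b then 1 else 0)"
    using coordinate_functional[OF b(1)] by blast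
  have "\<phi> (\<iota> b) = 1"
    using bspec[OF \<phi> b(1)] by simp
  then have "(if b' = b then 1 else 0 :: 'r fract) = 1"
    using bspec[OF \<phi> b(2)] eq by simp
  then show "b = b'"
    by (simp split: if_splits)
qed

lemma independent_Kbasis: "K.independent Kbasis"
proof
  assume "K.dependent Kbasis"
  then obtain b where b: "b \<in> basis" and dep: "\<iota> b \<in> K.span (Kbasis - {\<iota> b})"
    by (auto simp: K.dependent_def Kbasis_conv)
  obtain \<phi> where hom: "module_hom sK (*) \<phi>"
    and \<phi>: "\<forall>b'\<in>basis. \<phi> (\<iota> b') = (if b' = b then 1 else 0)"
    using coordinate_functional[OF b] by blast
  interpret \<phi>: module_hom sK "(*)" \<phi> by fact
  from dep have "\<phi> (\<iota> b) = 0"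
    by (induction rule: K.span_induct_alt)
      (auto simp: \<phi>.add \<phi>.scale Kbasis_conv \<phi> split: if_splits)
  then show False using \<phi> b by simp
qed

lemma inj_\<iota>C: "inj_on (\<lambda>(lam, s, t). \<iota> (C lam s t)) (cell_index \<Lambda> T)"
proof -
  have "(\<lambda>(lam, s, t). \<iota> (C lam s t)) = \<iota> \<circ> (\<lambda>(lam, s, t). C lam s t)"
    by auto
  then show ?thesis
    using comp_inj_on[OF inj_C inj_on_\<iota>_basis[unfolded basis_def]] by argo
qed

lemma \<iota>_ideal:
  assumes "a \<in> ideal lam"
  shows "\<iota> a \<in> cell_ideal sK \<Lambda> gt T (\<lambda>lam s t. \<iota> (C lam s t)) lam"
  using assms unfolding cell_ideal_def
proof (induction rule: span_induct_alt)
  case base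
  then show ?case by (simp add: \<iota>_zero K.span_zero)
next
  case (step r x y)
  then have "\<iota> x \<in> {\<iota> (C mu y z) | mu y z. mu \<in> \<Lambda> \<and> gt mu lam \<and> y \<in> T mu \<and> z \<in> T mu}"
    by blast
  with step.IH show ?case
    by (simp add: \<iota>_add \<iota>_scale K.span_add K.span_scale K.span_base)
qed

abbreviation Kstar :: "'b \<Rightarrow> 'b" where
  "Kstar \<equiv> cell_star sK \<Lambda> T (\<lambda>lam s t. \<iota> (C lam s t))"

lemma Kstar_hom: "module_hom sK sK Kstar"
  and Kstar_\<iota>: "Kstar (\<iota> a) = \<iota> (star a)"
proof -
  define i where "i = inv_into basis \<iota>"
  have i: "i (\<iota> b) = b" if "b \<in> basis" for b
    using that inj_on_\<iota>_basis by (simp add: i_def)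
  have fin: "finite Kbasis" by (simp add: Kbasis_conv finite_basis)
  obtain \<phi> where hom: "module_hom sK sK \<phi>"
    and \<phi>b: "\<And>b. b \<in> Kbasis \<Longrightarrow> \<phi> b = \<iota> (star (i b))"
    using free_module_hom_exists[OF K.module_axioms K.module_axioms fin
          independent_Kbasis span_Kbasis, where f = "\<lambda>b. \<iota> (star (i b))"] by blast
  interpret \<phi>: module_hom sK sK \<phi> by fact
  have C: "\<phi> (\<iota> (C lam s t)) = \<iota> (star (C lam s t))" if "lam \<in> \<Lambda>" "s \<in> T lam" "t \<in> T lam" for lam s t
    using basisI[OF that] by (simp add: \<phi>b Kbasis_conv i)
  have \<phi>\<iota>: "\<phi> (\<iota> a) = \<iota> (star a)" for a
    by (induction a rule: basis_induct)
      (simp_all add: \<iota>_zero \<iota>_add \<iota>_scale \<phi>.add \<phi>.scale star.add star.scale C)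
  have Kstar: "Kstar = \<phi>"
    by (rule cell_star_eqI[OF hom]) (simp_all add: C star_C span_Kbasis flip: Kbasis_def)
  show "module_hom sK sK Kstar" and "Kstar (\<iota> a) = \<iota> (star a)"
    unfolding Kstar by (fact hom, fact \<phi>\<iota>)
qed

sublocale Kstar: module_hom sK sK Kstar
  by (rule Kstar_hom)

lemma Kstar_anti_isomorphism: "anti_isomorphism Kstar"
proof -
  have "K.subspace {x. Kstar (Kstar x) = x}"
    by (rule K.subspaceI) (simp_all add: Kstar.add Kstar.scale)
  then have inv: "Kstar (Kstar x) = x" for x
    using K_spanned[of "{x. Kstar (Kstar x) = x}" x] by (simp add: Kstar_\<iota> star_star)
  have "K.subspace {y. Kstar (\<iota> a * y) = Kstar y * Kstar (\<iota> a)}" for a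
    by (rule K.subspaceI) (simp_all add: Kstar.add Kstar.scale distrib_left distrib_right sK_mult_left sK_mult_right)
  then have 1: "Kstar (\<iota> a * y) = Kstar y * Kstar (\<iota> a)" for a y
    using K_spanned[of "{y. Kstar (\<iota> a * y) = Kstar y * Kstar (\<iota> a)}" y]
    by (simp add: Kstar_\<iota> star_mult flip: \<iota>_mult)
  have "K.subspace {x. Kstar (x * y) = Kstar y * Kstar x}" for y
    by (rule K.subspaceI) (simp_all add: Kstar.add Kstar.scale distrib_left distrib_right sK_mult_left sK_mult_right)
  then have "Kstar (x * y) = Kstar y * Kstar x" for x y
    using K_spanned[of "{x. Kstar (x * y) = Kstar y * Kstar x}" x] by (simp add: 1)
  moreover have "bij Kstar"
    by (rule involuntory_imp_bij) (rule inv)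
  moreover have "Kstar 1 = 1"
    using Kstar_\<iota>[of 1] by (simp add: \<iota>_one star_one)
  ultimately show ?thesis
    by (simp add: anti_isomorphism_def Kstar.add)
qed

text \<open>The elements \<open>x\<close> for which suitable coefficients exist form a \<open>K\<close>-subspace: coefficients for sums and
  multiples are the sums and multiples of the coefficients, still independent of \<open>s\<close>.\<close>

lemma Kcell_action:
  assumes lam: "lam \<in> \<Lambda>" "t \<in> T lam"
  shows "\<exists>r. \<forall>s\<in>T lam. \<iota> (C lam s t) * x - (\<Sum>v\<in>T lam. sK (r v) (\<iota> (C lam s v)))
      \<in> cell_ideal sK \<Lambda> gt T (\<lambda>lam s t. \<iota> (C lam s t)) lam"
proof -
  let ?I = "cell_ideal sK \<Lambda> gt T (\<lambda>lam s t. \<iota> (C lam s t)) lam"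
  let ?d = "\<lambda>x r s. \<iota> (C lam s t) * x - (\<Sum>v\<in>T lam. sK (r v) (\<iota> (C lam s v)))"
  let ?S = "{x. \<exists>r. \<forall>s\<in>T lam. ?d x r s \<in> ?I}"
  have I: "K.subspace ?I" by (simp add: cell_ideal_def)
  have "K.subspace ?S"
  proof (rule K.subspaceI)
    have "\<forall>s\<in>T lam. ?d 0 (\<lambda>_. 0) s \<in> ?I"
      using I by (simp add: K.subspace_0)
    then show "0 \<in> ?S"
      unfolding mem_Collect_eq by (rule exI[of _ "\<lambda>_. 0"])
  next
    fix x y assume "x \<in> ?S" "y \<in> ?S"
    then obtain r q where "\<forall>s\<in>T lam. ?d x r s \<in> ?I" "\<forall>s\<in>T lam. ?d y q s \<in> ?I" by blast
    moreover have "?d (x + y) (\<lambda>v. r v + q v) s = ?d x r s + ?d y q s" for s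
      by (simp add: distrib_left K.scale_left_distrib sum.distrib)
    ultimately have "\<forall>s\<in>T lam. ?d (x + y) (\<lambda>v. r v + q v) s \<in> ?I"
      using K.subspace_add[OF I] by (simp only: Ball_def) blast
    then show "x + y \<in> ?S"
      unfolding mem_Collect_eq by (rule exI[of _ "\<lambda>v. r v + q v"])
  next
    fix k x assume "x \<in> ?S"
    then obtain r where "\<forall>s\<in>T lam. ?d x r s \<in> ?I" by blast
    moreover have "?d (sK k x) (\<lambda>v. k * r v) s = sK k (?d x r s)" for s
      by (simp add: sK_mult_right K.scale_right_diff_distrib K.scale_sum_right)
    ultimately have "\<forall>s\<in>T lam. ?d (sK k x) (\<lambda>v. k * r v) s \<in> ?I"
      using K.subspace_scale[OF I] by (simp only: Ball_def) blast
    then show "sK k x \<in> ?S"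
      unfolding mem_Collect_eq by (rule exI[of _ "\<lambda>v. k * r v"])
  qed
  moreover have "\<iota> a \<in> ?S" for a
  proof -
    obtain r where "\<And>s. s \<in> T lam \<Longrightarrow> C lam s t * a - (\<Sum>v\<in>T lam. sR (r v) (C lam s v)) \<in> ideal lam"
      using cell_action[OF lam] by blast
    from \<iota>_ideal[OF this] have "\<forall>s\<in>T lam. ?d (\<iota> a) (\<lambda>v. to_fract (r v)) s \<in> ?I"
      by (simp add: \<iota>_diff \<iota>_sum \<iota>_scale \<iota>_mult)
    then show ?thesis
      unfolding mem_Collect_eq by (rule exI[of _ "\<lambda>v. to_fract (r v)"])
  qed
  ultimately show ?thesis using K_spanned by blast
qed

theorem scalar_extension_cell_datum: "cell_datum sK \<Lambda> gt T (\<lambda>lam s t. \<iota> (C lam s t))"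
  unfolding cell_datum_def
  using extension finite_poset strict_poset finite_T inj_\<iota>C independent_Kbasis span_Kbasis
    Kcell_action Kstar_anti_isomorphism
  by (simp add: is_scalar_extension_def Kbasis_def)

lemma scalar_extension_JM_family:
  assumes "JM_family sR \<Lambda> gt T C tgt M L c"
  shows "JM_family sK \<Lambda> gt T (\<lambda>lam s t. \<iota> (C lam s t)) tgt M (\<lambda>i. \<iota> (L i)) (\<lambda>p i. to_fract (c p i))"
proof -
  let ?I = "cell_ideal sK \<Lambda> gt T (\<lambda>lam s t. \<iota> (C lam s t))"
  have "\<exists>r. \<forall>s\<in>T lam. \<iota> (C lam s t) * \<iota> (L i)
          - (sK (to_fract (c (lam, t) i)) (\<iota> (C lam s t))
             + (\<Sum>v\<in>{v \<in> T lam. tab_gt gt tgt (lam, v) (lam, t)}. sK (r v) (\<iota> (C lam s v)))) \<in> ?I lam"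
    if idx: "i \<in> {1..M}" "lam \<in> \<Lambda>" "t \<in> T lam" for i lam t
  proof -
    obtain r where "\<forall>s\<in>T lam. C lam s t * L i - (sR (c (lam, t) i) (C lam s t)
       + (\<Sum>v\<in>{v \<in> T lam. tab_gt gt tgt (lam, v) (lam, t)}. sR (r v) (C lam s v))) \<in> ideal lam"
      using JM_family_action[OF assms idx] ..
    then have "\<forall>s\<in>T lam. \<iota> (C lam s t) * \<iota> (L i) - (sK (to_fract (c (lam, t) i)) (\<iota> (C lam s t))
       + (\<Sum>v\<in>{v \<in> T lam. tab_gt gt tgt (lam, v) (lam, t)}. sK (to_fract (r v)) (\<iota> (C lam s v)))) \<in> ?I lam"
      by (auto dest!: bspec \<iota>_ideal simp: \<iota>_diff \<iota>_add \<iota>_sum \<iota>_scale \<iota>_mult)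
    then show ?thesis by (rule exI[of _ "\<lambda>v. to_fract (r v)"])
  qed
  then show ?thesis
    using assms unfolding JM_family_def
    by (simp add: Kstar_\<iota> flip: \<iota>_mult)
qed

end

section \<open>Products of commuting elements\<close>

lemma commuting_prod_empty: "commuting_prod f {} = 1"
  by (simp add: commuting_prod_def)

lemma commuting_prod_insert:
  assumes "finite I" "i \<notin> I"
    and "\<And>x y. \<lbrakk>x \<in> insert i I; y \<in> insert i I\<rbrakk> \<Longrightarrow> f x * f y = f y * f x"
  shows "commuting_prod f (insert i I) = f i * commuting_prod f I"
proof -
  interpret comp_fun_commute_on "insert i I" "\<lambda>i x. f i * x"
    by unfold_locales (use assms(3) in \<open>auto simp: fun_eq_iff simp flip: mult.assoc\<close>)
  show ?thesis
    unfolding commuting_prod_def using fold_insert assms(1,2) by simp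
qed

lemma commuting_prod_induct:
  assumes "finite I" and "\<And>x y. \<lbrakk>x \<in> I; y \<in> I\<rbrakk> \<Longrightarrow> f x * f y = f y * f x"
    and "P 1" "\<And>i x. \<lbrakk>i \<in> I; P x\<rbrakk> \<Longrightarrow> P (f i * x)"
  shows "P (commuting_prod f I)"
  using assms
proof (induction I)
  case empty
  then show ?case by (simp add: commuting_prod_empty)
next
  case (insert i I)
  have "commuting_prod f (insert i I) = f i * commuting_prod f I"
    by (rule commuting_prod_insert[OF insert.hyps insert.prems(1)])
  with insert show ?case by simp
qed

lemma commuting_prod_commute:
  assumes "finite I" and "\<And>x y. \<lbrakk>x \<in> I; y \<in> I\<rbrakk> \<Longrightarrow> f x * f y = f y * f x"
    and y: "\<And>i. i \<in> I \<Longrightarrow> f i * y = y * f i"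
  shows "commuting_prod f I * y = y * commuting_prod f I"
proof (rule commuting_prod_induct[where P = "\<lambda>x. x * y = y * x", OF assms(1,2)])
  fix i x assume "i \<in> I" and x: "x * y = y * x"
  have "f i * x * y = f i * y * x"
    by (simp add: x mult.assoc)
  also have "\<dots> = y * (f i * x)"
    by (simp add: y[OF \<open>i \<in> I\<close>] mult.assoc)
  finally show "f i * x * y = y * (f i * x)" .
qed simp_all

lemma commuting_prod_reindex:
  assumes "inj_on h I"
  shows "commuting_prod f (h ` I) = commuting_prod (\<lambda>i. f (h i)) I"
  by (simp add: commuting_prod_def fold_image[OF assms] comp_def)

text \<open>For interpolation polynomials: evaluating a product of operators on a common eigenvector multiplies
  the eigenvalues.\<close>

lemma commuting_prod_eigenvector:
  assumes "module scale" and right: "\<And>r x y. scale r x * y = scale r (x * y)"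
    and "finite I" and "\<And>x y. \<lbrakk>x \<in> I; y \<in> I\<rbrakk> \<Longrightarrow> f x * f y = f y * f x"
    and "\<And>i. i \<in> I \<Longrightarrow> x * f i = scale (k i) x"
  shows "x * commuting_prod f I = scale (\<Prod>i\<in>I. k i) x"
  using assms(3-5)
proof (induction I)
  interpret module scale by fact
  case empty
  then show ?case by (simp add: commuting_prod_empty)
next
  interpret module scale by fact
  case (insert i I)
  have "commuting_prod f (insert i I) = f i * commuting_prod f I"
    by (rule commuting_prod_insert[OF insert.hyps insert.prems(1)])
  with insert show ?case
    by (simp add: right flip: mult.assoc)
qed

section \<open>Idempotents of a separating family over a field\<close>

text \<open>Here the base ring is already a field, so that the idempotents live in the algebra itself.\<close>

locale separated_JM = cell_algebra scale \<Lambda> gt T C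
  for scale :: "'k::field \<Rightarrow> 'a::{ring,monoid_mult} \<Rightarrow> 'a"
    and \<Lambda> :: "'l set" and gt :: "'l \<Rightarrow> 'l \<Rightarrow> bool"
    and T :: "'l \<Rightarrow> 's set" and C :: "'l \<Rightarrow> 's \<Rightarrow> 's \<Rightarrow> 'a" +
  fixes tgt :: "'l \<Rightarrow> 's \<Rightarrow> 's \<Rightarrow> bool"
    and M :: nat and L :: "nat \<Rightarrow> 'a" and c :: "'l \<times> 's \<Rightarrow> nat \<Rightarrow> 'k"
  assumes tgt_order: "lam \<in> \<Lambda> \<Longrightarrow> strict_poset (T lam) (tgt lam)"
    and JM: "JM_family scale \<Lambda> gt T C tgt M L c"
    and separate: "JM_separate \<Lambda> T M c"
begin

sublocale vector_space scale
  using module_axioms by (simp add: module_iff_vector_space)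

abbreviation tabs :: "('l \<times> 's) set" where "tabs \<equiv> Sigma \<Lambda> T"

abbreviation dominates :: "'l \<times> 's \<Rightarrow> 'l \<times> 's \<Rightarrow> bool" where "dominates \<equiv> tab_gt gt tgt"

lemma finite_tabs: "finite tabs"
  using finite_poset finite_T by blast

lemma dominates_irrefl: "p \<in> tabs \<Longrightarrow> \<not> dominates p p"
  using gt_irrefl tgt_order by (force simp: tab_gt_def strict_poset_def irreflp_on_def)

lemma dominates_trans:
  assumes "dominates p q" "dominates q r" "p \<in> tabs" "q \<in> tabs" "r \<in> tabs"
  shows "dominates p r"
proof -
  have "tgt lam x z" if "tgt lam x y" "tgt lam y z" "lam \<in> \<Lambda>" "x \<in> T lam" "y \<in> T lam" "z \<in> T lam"
    for lam x y z
    using tgt_order[OF that(3)] that by (auto simp: strict_poset_def dest: transp_onD)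
  moreover have "gt (fst p) (fst r)" if "gt (fst p) (fst q)" "gt (fst q) (fst r)"
    using gt_trans[OF that] assms by auto
  ultimately show ?thesis
    using assms unfolding tab_gt_def by (auto simp: mem_Times_iff)
qed

text \<open>Induction from the larger indices down to the smaller ones, possible because there are finitely
  many indices.\<close>

lemma tab_induct [consumes 1, case_names less]:
  assumes "p \<in> tabs"
    and step: "\<And>p. \<lbrakk>p \<in> tabs; \<And>q. \<lbrakk>q \<in> tabs; dominates q p\<rbrakk> \<Longrightarrow> P q\<rbrakk> \<Longrightarrow> P p"
  shows "P p"
proof -
  define R where "R = {(q, p). q \<in> tabs \<and> p \<in> tabs \<and> dominates q p}"
  have "trans R"
    unfolding R_def trans_def using dominates_trans by blast
  then have "acyclic R"
    using dominates_irrefl by (auto simp: acyclic_def trancl_id R_def)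
  moreover have "finite R"
    by (rule finite_subset[of _ "tabs \<times> tabs"]) (auto simp: R_def finite_poset finite_T)
  ultimately have "wf R" by (simp add: finite_acyclic_wf)
  then have "p \<in> tabs \<longrightarrow> P p"
  proof (induction p rule: wf_induct_rule)
    case (less p)
    show ?case
    proof
      assume p: "p \<in> tabs"
      show "P p"
      proof (rule step[OF p])
        fix q assume "q \<in> tabs" "dominates q p"
        with p less show "P q" by (simp add: R_def)
      qed
    qed
  qed
  with assms(1) show ?thesis by blast
qed

lemma L_commute: "\<lbrakk>i \<in> {1..M}; j \<in> {1..M}\<rbrakk> \<Longrightarrow> L i * L j = L j * L i"
  and star_L: "i \<in> {1..M} \<Longrightarrow> star (L i) = L i"
  using JM by (simp_all add: JM_family_def)

definition factor :: "'l \<times> 's \<Rightarrow> nat \<Rightarrow> 'k \<Rightarrow> 'a" where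
  "factor p i d = scale (inverse (c p i - d)) (L i - scale d 1)"

definition other_contents :: "'l \<times> 's \<Rightarrow> nat \<Rightarrow> 'k set" where
  "other_contents p i = {d \<in> contents \<Lambda> T c i. d \<noteq> c p i}"

definition F :: "'l \<times> 's \<Rightarrow> 'a" where
  "F p = commuting_prod (\<lambda>i. commuting_prod (factor p i) (other_contents p i)) {1..M}"

lemma finite_other_contents: "finite (other_contents p i)"
  using finite_tabs by (simp add: other_contents_def contents_def)

lemma mult_factor: "x * factor p i d = scale (inverse (c p i - d)) (x * L i - scale d x)"
  by (simp add: factor_def scale_mult_right right_diff_distrib)

lemma factor_mult: "factor p i d * x = scale (inverse (c p i - d)) (L i * x - scale d x)"
  by (simp add: factor_def scale_mult_left left_diff_distrib)

lemma factor_commute_L: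
  "\<lbrakk>i \<in> {1..M}; j \<in> {1..M}\<rbrakk> \<Longrightarrow> factor p i d * L j = L j * factor p i d"
  by (simp add: factor_mult mult_factor L_commute)

lemma factor_commute:
  assumes "i \<in> {1..M}" "j \<in> {1..M}"
  shows "factor p i d * factor q j e = factor q j e * factor p i d"
  using factor_commute_L[OF assms, of p d]
  by (simp add: mult_factor[of "factor p i d" q j e] factor_mult[of q j e "factor p i d"])

lemma inner_commute:
  assumes "i \<in> {1..M}" "j \<in> {1..M}"
  shows "commuting_prod (factor p i) (other_contents p i) * commuting_prod (factor p j) (other_contents p j) =
    commuting_prod (factor p j) (other_contents p j) * commuting_prod (factor p i) (other_contents p i)"
proof (rule commuting_prod_commute[OF finite_other_contents factor_commute[OF assms(1,1)]])
  fix d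
  show "factor p i d * commuting_prod (factor p j) (other_contents p j) =
      commuting_prod (factor p j) (other_contents p j) * factor p i d"
    by (rule commuting_prod_commute[OF finite_other_contents factor_commute[OF assms(2,2)], symmetric])
      (rule factor_commute[OF assms(2,1)])
qed

text \<open>Reduces statements about the double product \<open>F p\<close> to single linear factors.\<close>

lemma F_induct:
  assumes one: "P 1"
    and step: "\<And>i d x. \<lbrakk>i \<in> {1..M}; d \<in> other_contents p i; P x\<rbrakk> \<Longrightarrow> P (factor p i d * x)"
  shows "P (F p)"
  unfolding F_def
proof (rule commuting_prod_induct[where P = P, OF _ inner_commute one])
  fix i x assume i: "i \<in> {1..M}" and "P x"
  have "\<forall>x. P x \<longrightarrow> P (commuting_prod (factor p i) (other_contents p i) * x)"
  proof (rule commuting_prod_induct[where P = "\<lambda>y. \<forall>x. P x \<longrightarrow> P (y * x)",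
        OF finite_other_contents factor_commute[OF i i]])
    fix d y assume "d \<in> other_contents p i" and "\<forall>x. P x \<longrightarrow> P (y * x)"
    then show "\<forall>x. P x \<longrightarrow> P (factor p i d * y * x)"
      using step[OF i] by (simp add: mult.assoc)
  qed simp
  with \<open>P x\<close> show "P (commuting_prod (factor p i) (other_contents p i) * x)" by blast
qed simp_all

lemma F_commute_L:
  assumes i: "i \<in> {1..M}"
  shows "F p * L i = L i * F p"
  unfolding F_def
proof (rule commuting_prod_commute[OF _ inner_commute])
  fix j assume j: "j \<in> {1..M}"
  show "commuting_prod (factor p j) (other_contents p j) * L i = L i * commuting_prod (factor p j) (other_contents p j)"
    by (rule commuting_prod_commute[OF finite_other_contents factor_commute[OF j j] factor_commute_L[OF j i]])
qed simp_all

lemma star_F: "star (F p) = F p"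
proof -
  have "star (F p) = F p \<and> (\<forall>i\<in>{1..M}. \<forall>d. F p * factor p i d = factor p i d * F p)"
  proof (rule F_induct[where P =
        "\<lambda>x. star x = x \<and> (\<forall>i\<in>{1..M}. \<forall>d. x * factor p i d = factor p i d * x)"])
    fix i d x
    assume i: "i \<in> {1..M}"
      and x: "star x = x \<and> (\<forall>i\<in>{1..M}. \<forall>d. x * factor p i d = factor p i d * x)"
    have "star (factor p i d) = factor p i d"
      by (simp add: factor_def star.scale star.diff star_L[OF i] star_one)
    then have "star (factor p i d * x) = factor p i d * x"
      using x i by (simp add: star_mult)
    moreover have "factor p i d * x * factor p j e = factor p j e * (factor p i d * x)"
      if j: "j \<in> {1..M}" for j e
    proof -
      have "factor p i d * x * factor p j e = factor p i d * factor p j e * x"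
        using x j by (simp add: mult.assoc)
      then show ?thesis
        by (simp add: factor_commute[OF i j] mult.assoc)
    qed
    ultimately show "star (factor p i d * x) = factor p i d * x \<and>
      (\<forall>j\<in>{1..M}. \<forall>e. factor p i d * x * factor p j e = factor p j e * (factor p i d * x))"
      by blast
  qed (simp add: star_one)
  then show ?thesis by blast
qed

text \<open>\<open>F p\<close> evaluates on the eigenvector to the interpolation polynomial at the contents of \<open>r\<close>. For
  \<open>r = p\<close> every factor is 1. For \<open>r \<noteq> p\<close> separation provides an \<open>i\<close> at which the content of \<open>r\<close>
  differs from that of \<open>p\<close>, and the factor for this content vanishes.\<close>

lemma eigenvector_F:
  assumes x: "\<And>i. i \<in> {1..M} \<Longrightarrow> x * L i = scale (c r i) x" and "r \<in> tabs" "p \<in> tabs"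
  shows "x * F p = (if r = p then x else 0)"
proof -
  let ?k = "\<lambda>i d. inverse (c p i - d) * (c r i - d)"
  have one: "x * factor p i d = scale (?k i d) x" if "i \<in> {1..M}" for i d
    by (simp add: mult_factor x[OF that] flip: scale_left_diff_distrib)
  have inner: "x * commuting_prod (factor p i) (other_contents p i) = scale (\<Prod>d\<in>other_contents p i. ?k i d) x"
    if i: "i \<in> {1..M}" for i
    by (rule commuting_prod_eigenvector[OF module_axioms scale_mult_left finite_other_contents
          factor_commute[OF i i] one[OF i]])
  have *: "x * F p = scale (\<Prod>i\<in>{1..M}. \<Prod>d\<in>other_contents p i. ?k i d) x"
    unfolding F_def
    by (rule commuting_prod_eigenvector[OF module_axioms scale_mult_left finite_atLeastAtMost
          inner_commute inner])
  show ?thesis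
  proof (cases "r = p")
    case True
    then have "(\<Prod>i\<in>{1..M}. \<Prod>d\<in>other_contents p i. ?k i d) = 1"
      by (intro prod.neutral ballI) (auto simp: other_contents_def)
    with * True show ?thesis by simp
  next
    case False
    then obtain i where i: "i \<in> {1..M}" "c r i \<noteq> c p i"
      using separate assms(2,3) unfolding JM_separate_def by blast
    then have "c r i \<in> other_contents p i"
      using \<open>r \<in> tabs\<close> by (auto simp: other_contents_def contents_def)
    then have "(\<Prod>d\<in>other_contents p i. ?k i d) = 0"
      using finite_other_contents by (auto intro!: prod_zero)
    then have "(\<Prod>i\<in>{1..M}. \<Prod>d\<in>other_contents p i. ?k i d) = 0"
      using i(1) by (intro prod_zero) auto
    with * False show ?thesis by simp
  qed
qed

text \<open>The room for error terms when \<open>L i\<close> acts on \<open>C lam s t\<close> from the right. Keeping the left index \<open>s\<close>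
  inside the layer \<open>lam\<close> is what later confines \<open>C lam s w * F (lam, v)\<close> to a single line; in
  higher layers the left index is free.\<close>

definition higher :: "'l \<Rightarrow> 's \<Rightarrow> 's \<Rightarrow> 'a set" where
  "higher lam s t = span {C mu y z | mu y z. mu \<in> \<Lambda> \<and> y \<in> T mu \<and> z \<in> T mu \<and>
     dominates (mu, z) (lam, t) \<and> (mu = lam \<longrightarrow> y = s)}"

lemma subspace_higher: "subspace (higher lam s t)"
  by (simp add: higher_def)

lemma C_in_higher:
  "\<lbrakk>mu \<in> \<Lambda>; y \<in> T mu; z \<in> T mu; dominates (mu, z) (lam, t); mu = lam \<longrightarrow> y = s\<rbrakk>
    \<Longrightarrow> C mu y z \<in> higher lam s t"
  unfolding higher_def by (rule span_base) blast

lemma higher_minimal: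
  assumes "subspace S"
    and "\<And>mu y z. \<lbrakk>mu \<in> \<Lambda>; y \<in> T mu; z \<in> T mu; dominates (mu, z) (lam, t); mu = lam \<longrightarrow> y = s\<rbrakk>
      \<Longrightarrow> C mu y z \<in> S"
  shows "higher lam s t \<subseteq> S"
  unfolding higher_def by (rule span_minimal) (use assms in auto)

lemma higher_mono:
  assumes "lam \<in> \<Lambda>" "t \<in> T lam" "mu \<in> \<Lambda>" "z \<in> T mu" "dominates (mu, z) (lam, t)" "mu = lam \<longrightarrow> y = s"
  shows "higher mu y z \<subseteq> higher lam s t"
proof (rule higher_minimal[OF subspace_higher])
  fix nu x w
  assume nu: "nu \<in> \<Lambda>" "x \<in> T nu" "w \<in> T nu" "dominates (nu, w) (mu, z)" "nu = mu \<longrightarrow> x = y"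
  have "dominates (nu, w) (lam, t)"
    by (rule dominates_trans[OF nu(4) assms(5)]) (use nu assms in auto)
  moreover have "x = s" if "nu = lam"
  proof -
    have "mu = lam"
    proof (rule ccontr)
      assume "mu \<noteq> lam"
      then have "gt mu lam" "gt lam mu"
        using nu(4) assms(5) that by (auto simp: tab_gt_def)
      then show False
        using gt_trans[of lam mu lam] gt_irrefl assms by blast
    qed
    then show ?thesis using that nu(5) assms(6) by simp
  qed
  ultimately show "C nu x w \<in> higher lam s t"
    using nu by (intro C_in_higher) auto
qed

lemma ideal_higher: "ideal lam \<subseteq> higher lam s t" if "lam \<in> \<Lambda>"
  unfolding cell_ideal_def
proof (rule span_minimal[OF _ subspace_higher], clarify)
  fix mu y z assume mu: "mu \<in> \<Lambda>" "gt mu lam" "y \<in> T mu" "z \<in> T mu"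
  then show "C mu y z \<in> higher lam s t"
    using gt_irrefl that by (intro C_in_higher) (auto simp: tab_gt_def)
qed

text \<open>The triangularity axiom with its two kinds of error terms (larger \<open>v\<close> in the same layer, and
  higher layers) merged into one subspace.\<close>

lemma JM_action:
  assumes "i \<in> {1..M}" "lam \<in> \<Lambda>" "s \<in> T lam" "t \<in> T lam"
  shows "C lam s t * L i - scale (c (lam, t) i) (C lam s t) \<in> higher lam s t"
proof -
  obtain r where
    "C lam s t * L i - (scale (c (lam, t) i) (C lam s t) +
       (\<Sum>v\<in>{v \<in> T lam. dominates (lam, v) (lam, t)}. scale (r v) (C lam s v))) \<in> ideal lam"
    using JM_family_action[OF JM assms(1,2,4)] assms(3) by meson
  then have "C lam s t * L i - (scale (c (lam, t) i) (C lam s t) +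
       (\<Sum>v\<in>{v \<in> T lam. dominates (lam, v) (lam, t)}. scale (r v) (C lam s v))) \<in> higher lam s t"
    using ideal_higher assms by blast
  moreover have "(\<Sum>v\<in>{v \<in> T lam. dominates (lam, v) (lam, t)}. scale (r v) (C lam s v)) \<in> higher lam s t"
    using assms by (intro subspace_sum subspace_scale subspace_higher C_in_higher) auto
  ultimately have "C lam s t * L i - (scale (c (lam, t) i) (C lam s t) +
       (\<Sum>v\<in>{v \<in> T lam. dominates (lam, v) (lam, t)}. scale (r v) (C lam s v))) +
       (\<Sum>v\<in>{v \<in> T lam. dominates (lam, v) (lam, t)}. scale (r v) (C lam s v)) \<in> higher lam s t"
    by (intro subspace_add subspace_higher)
  then show ?thesis by (simp add: algebra_simps)
qed

lemma higher_L:
  assumes i: "i \<in> {1..M}" and lam: "lam \<in> \<Lambda>" "t \<in> T lam" and x: "x \<in> higher lam s t"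
  shows "x * L i \<in> higher lam s t"
proof -
  have "subspace {x. x * L i \<in> higher lam s t}"
    by (rule subspaceI)
      (auto simp: distrib_right scale_mult_left intro: subspace_0 subspace_add subspace_scale subspace_higher)
  then have "higher lam s t \<subseteq> {x. x * L i \<in> higher lam s t}"
  proof (rule higher_minimal, clarify)
    fix mu y z
    assume mu: "mu \<in> \<Lambda>" "y \<in> T mu" "z \<in> T mu" "dominates (mu, z) (lam, t)" "mu = lam \<longrightarrow> y = s"
    have "C mu y z * L i - scale (c (mu, z) i) (C mu y z) \<in> higher lam s t"
      using JM_action[OF i mu(1-3)] higher_mono[OF lam mu(1,3,4,5)] by blast
    moreover have "scale (c (mu, z) i) (C mu y z) \<in> higher lam s t"
      using C_in_higher[OF mu] subspace_scale[OF subspace_higher] by blast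
    ultimately show "C mu y z * L i \<in> higher lam s t"
      using subspace_add[OF subspace_higher] by (metis diff_add_cancel)
  qed
  with x show ?thesis by blast
qed

section \<open>Simultaneous eigenvectors\<close>

text \<open>Half-way to \<open>f\<close>: only the right-hand idempotent is applied. These are the simultaneous
  eigenvectors of right multiplication by the \<open>L i\<close>.\<close>

definition g :: "'l \<Rightarrow> 's \<Rightarrow> 's \<Rightarrow> 'a" where
  "g lam s t = C lam s t * F (lam, t)"

text \<open>Each factor of \<open>F (lam, t)\<close> is normalised so that it acts on \<open>C lam s t\<close> as the identity modulo
  \<open>higher lam s t\<close>, and this subspace is stable under all factors.\<close>

lemma g_triangular:
  assumes "lam \<in> \<Lambda>" "s \<in> T lam" "t \<in> T lam"
  shows "g lam s t - C lam s t \<in> higher lam s t"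
proof -
  let ?W = "higher lam s t" and ?b = "C lam s t"
  note W = subspace_higher[of lam s t]
  have "(\<forall>w\<in>?W. w * F (lam, t) \<in> ?W) \<and> ?b * F (lam, t) - ?b \<in> ?W"
  proof (rule F_induct[where P = "\<lambda>x. (\<forall>w\<in>?W. w * x \<in> ?W) \<and> ?b * x - ?b \<in> ?W"])
    show "(\<forall>w\<in>?W. w * 1 \<in> ?W) \<and> ?b * 1 - ?b \<in> ?W"
      using W by (simp add: subspace_0)
  next
    fix i d x
    assume i: "i \<in> {1..M}" and d: "d \<in> other_contents (lam, t) i"
      and x: "(\<forall>w\<in>?W. w * x \<in> ?W) \<and> ?b * x - ?b \<in> ?W"
    let ?e = "inverse (c (lam, t) i - d)"
    have stable: "w * factor (lam, t) i d \<in> ?W" if "w \<in> ?W" for w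
      using higher_L[OF i assms(1,3) that] that W
      by (simp add: mult_factor subspace_scale subspace_diff)
    have "?b * factor (lam, t) i d - ?b = scale ?e (?b * L i - scale (c (lam, t) i) ?b)"
    proof -
      have "?b = scale ?e (scale (c (lam, t) i - d) ?b)"
        using d by (auto simp: other_contents_def)
      then have "?b * factor (lam, t) i d - ?b =
          scale ?e (?b * L i - scale d ?b) - scale ?e (scale (c (lam, t) i - d) ?b)"
        by (simp add: mult_factor)
      also have "\<dots> = scale ?e (?b * L i - scale (c (lam, t) i) ?b)"
        by (simp add: scale_left_diff_distrib flip: scale_right_diff_distrib)
      finally show ?thesis .
    qed
    then have "?b * factor (lam, t) i d - ?b \<in> ?W"
      using JM_action[OF i assms] W by (simp add: subspace_scale)
    then have "(?b * factor (lam, t) i d - ?b) * x + (?b * x - ?b) \<in> ?W"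
      using x W by (simp add: subspace_add)
    then have "?b * (factor (lam, t) i d * x) - ?b \<in> ?W"
      by (simp add: left_diff_distrib mult.assoc)
    moreover have "w * (factor (lam, t) i d * x) \<in> ?W" if "w \<in> ?W" for w
      using x stable[OF that] by (simp flip: mult.assoc)
    ultimately show "(\<forall>w\<in>?W. w * (factor (lam, t) i d * x) \<in> ?W) \<and>
        ?b * (factor (lam, t) i d * x) - ?b \<in> ?W"
      by blast
  qed
  then show ?thesis by (simp add: g_def)
qed

text \<open>The two claims need each other. Given both for all larger indices, \<open>F p\<close> annihilates every error
  term at \<open>p\<close>, so applying it to the triangular relation for \<open>L i\<close> leaves an exact eigenvector
  equation. Conversely, if \<open>p\<close> dominates \<open>q\<close>, then \<open>F q\<close> kills the new eigenvector by separation and the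
  error terms of \<open>p\<close> by the induction hypothesis, hence also \<open>C lam s t\<close>, which is their difference.\<close>

lemma g_eigenvector_and_C_F_zero:
  assumes "p \<in> tabs" "s \<in> T (fst p)"
  shows "(\<forall>i\<in>{1..M}. g (fst p) s (snd p) * L i = scale (c p i) (g (fst p) s (snd p))) \<and>
    (\<forall>q\<in>tabs. dominates p q \<longrightarrow> C (fst p) s (snd p) * F q = 0)"
  using assms
proof (induction p arbitrary: s rule: tab_induct)
  case (less p)
  obtain lam t where p: "p = (lam, t)" by (cases p)
  with less have lam: "lam \<in> \<Lambda>" "s \<in> T lam" "t \<in> T lam" by auto
  have kill: "x * F q = 0" if "x \<in> higher lam s t" "q \<in> tabs" "q = p \<or> dominates p q" for x q
  proof -
    have "subspace {x. x * F q = 0}"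
      by (rule subspaceI) (auto simp: distrib_right scale_mult_left)
    then have "higher lam s t \<subseteq> {x. x * F q = 0}"
    proof (rule higher_minimal, clarify)
      fix mu y z
      assume mu: "mu \<in> \<Lambda>" "y \<in> T mu" "z \<in> T mu" "dominates (mu, z) (lam, t)"
      then have "dominates (mu, z) q"
        using dominates_trans[of "(mu, z)" p q] that less.hyps p by auto
      then show "C mu y z * F q = 0"
        using less.IH[of "(mu, z)" y] mu p that(2) by auto
    qed
    with that show ?thesis by blast
  qed
  have eigen: "g lam s t * L i = scale (c p i) (g lam s t)" if i: "i \<in> {1..M}" for i
  proof -
    have "(C lam s t * L i - scale (c p i) (C lam s t)) * F p = 0"
      using JM_action[OF i lam] kill[of _ p] less.hyps p by blast
    then show ?thesis
      using F_commute_L[OF i, of p]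
      by (simp add: g_def p left_diff_distrib scale_mult_left mult.assoc)
  qed
  moreover have "C lam s t * F q = 0" if q: "q \<in> tabs" "dominates p q" for q
  proof -
    have "p \<noteq> q" using dominates_irrefl q by blast
    then have "g lam s t * F q = 0"
      using eigenvector_F[of "g lam s t" p q, OF eigen less.hyps q(1)] by simp
    moreover have "(g lam s t - C lam s t) * F q = 0"
      using kill g_triangular[OF lam] q by blast
    ultimately show ?thesis by (simp add: left_diff_distrib)
  qed
  ultimately show ?case by (simp add: p)
qed

lemma g_F:
  assumes "lam \<in> \<Lambda>" "s \<in> T lam" "t \<in> T lam" "q \<in> tabs"
  shows "g lam s t * F q = (if q = (lam, t) then g lam s t else 0)"
  using eigenvector_F[of "g lam s t" "(lam, t)" q] g_eigenvector_and_C_F_zero[of "(lam, t)" s] assms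
  by auto

text \<open>Larger layers contribute nothing at the contents of \<open>(lam, t)\<close>: computations followed by
  \<open>F (lam, t)\<close> may be done modulo the cell ideal.\<close>

lemma ideal_F:
  assumes "lam \<in> \<Lambda>" "t \<in> T lam" "x \<in> ideal lam"
  shows "x * F (lam, t) = 0"
proof -
  have "subspace {x. x * F (lam, t) = 0}"
    by (rule subspaceI) (auto simp: distrib_right scale_mult_left)
  moreover have "C mu y z * F (lam, t) = 0" if "mu \<in> \<Lambda>" "gt mu lam" "y \<in> T mu" "z \<in> T mu" for mu y z
    using g_eigenvector_and_C_F_zero[of "(mu, z)" y] that assms by (simp add: tab_gt_def)
  ultimately have "ideal lam \<subseteq> {x. x * F (lam, t) = 0}"
    unfolding cell_ideal_def by (intro span_minimal) auto
  with assms show ?thesis by blast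
qed

text \<open>The \<open>g lam s t\<close> arise from the basis by a unitriangular change.\<close>

lemma g_spans:
  assumes S: "subspace S" and g: "\<And>lam s t. \<lbrakk>lam \<in> \<Lambda>; s \<in> T lam; t \<in> T lam\<rbrakk> \<Longrightarrow> g lam s t \<in> S"
  shows "x \<in> S"
proof -
  have "C (fst p) s (snd p) \<in> S" if "p \<in> tabs" "s \<in> T (fst p)" for p s
    using that
  proof (induction p arbitrary: s rule: tab_induct)
    case (less p)
    then have p: "fst p \<in> \<Lambda>" "s \<in> T (fst p)" "snd p \<in> T (fst p)" by auto
    have "higher (fst p) s (snd p) \<subseteq> S"
      by (rule higher_minimal[OF S]) (use less.IH in force)
    then have "g (fst p) s (snd p) - C (fst p) s (snd p) \<in> S"
      using g_triangular[OF p] by blast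
    then show ?case
      using g[OF p] subspace_diff[OF S] by (metis diff_diff_eq2 add_diff_cancel_left')
  qed
  then have "C lam s t \<in> S" if "lam \<in> \<Lambda>" "s \<in> T lam" "t \<in> T lam" for lam s t
    using that by force
  then show ?thesis
    by (induction x rule: basis_induct) (use S in \<open>simp_all add: subspace_0 subspace_add subspace_scale\<close>)
qed

text \<open>The elements \<open>x\<close> with \<open>x * (F p * F q) = x * F p\<close> (or \<open>= 0\<close>) form a subspace that contains all the
  eigenvectors, hence contains 1.\<close>

lemma F_orthogonal:
  assumes "p \<in> tabs" "q \<in> tabs"
  shows "F p * F q = (if p = q then F p else 0)"
proof -
  have "subspace {x. x * (F p * F q) = x * (if p = q then F p else 0)}"
    by (rule subspaceI) (simp_all only: mem_Collect_eq distrib_right scale_mult_left mult_zero_left)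
  then have "1 \<in> {x. x * (F p * F q) = x * (if p = q then F p else 0)}"
    by (rule g_spans) (use assms in \<open>simp add: g_F flip: mult.assoc\<close>)
  then show ?thesis by simp
qed

lemma sum_F: "(\<Sum>p\<in>tabs. F p) = 1"
proof -
  have "subspace {x. x * (\<Sum>p\<in>tabs. F p) = x}"
    by (rule subspaceI) (simp_all only: mem_Collect_eq distrib_right scale_mult_left mult_zero_left)
  then have "1 \<in> {x. x * (\<Sum>p\<in>tabs. F p) = x}"
    by (rule g_spans) (use finite_tabs in \<open>simp add: sum_distrib_left g_F\<close>)
  then show ?thesis by simp
qed

text \<open>By triangularity within the layer, \<open>C lam s w\<close> is a combination of the \<open>g lam s v\<close>, with the same
  \<open>s\<close>, modulo the cell ideal. It is enough to know what \<open>F q\<close> does to those.\<close>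

lemma C_F_in:
  assumes S: "subspace S" and lam: "lam \<in> \<Lambda>" "s \<in> T lam" "w \<in> T lam"
    and ideal: "\<And>a. a \<in> ideal lam \<Longrightarrow> a * F q \<in> S"
    and g: "\<And>v. v \<in> T lam \<Longrightarrow> g lam s v * F q \<in> S"
  shows "C lam s w * F q \<in> S"
proof -
  have "C lam s (snd p) * F q \<in> S" if "p \<in> tabs" "fst p = lam" for p
    using that
  proof (induction p rule: tab_induct)
    case (less p)
    then have p: "snd p \<in> T lam" by auto
    have "subspace {x. x * F q \<in> S}"
      by (rule subspaceI) (use S in \<open>auto simp: distrib_right scale_mult_left subspace_0 subspace_add subspace_scale\<close>)
    then have "higher lam s (snd p) \<subseteq> {x. x * F q \<in> S}"
    proof (rule higher_minimal, clarify)
      fix mu y z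
      assume mu: "mu \<in> \<Lambda>" "y \<in> T mu" "z \<in> T mu" "dominates (mu, z) (lam, snd p)" "mu = lam \<longrightarrow> y = s"
      show "C mu y z * F q \<in> S"
      proof (cases "mu = lam")
        case True
        then show ?thesis using less.IH[of "(mu, z)"] mu less.prems by (cases p) auto
      next
        case False
        then have "C mu y z \<in> ideal lam"
          using mu by (intro C_in_ideal) (auto simp: tab_gt_def)
        then show ?thesis by (rule ideal)
      qed
    qed
    then have "(g lam s (snd p) - C lam s (snd p)) * F q \<in> S"
      using g_triangular[OF lam(1,2) p] by blast
    then have "g lam s (snd p) * F q - (g lam s (snd p) - C lam s (snd p)) * F q \<in> S"
      using g[OF p] subspace_diff[OF S] by blast
    then show ?case by (simp add: left_diff_distrib)
  qed
  from this[of "(lam, w)"] lam show ?thesis by simp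
qed

lemma C_F_same:
  assumes "lam \<in> \<Lambda>" "s \<in> T lam" "w \<in> T lam" "v \<in> T lam"
  obtains k where "C lam s w * F (lam, v) = scale k (g lam s v)"
proof -
  have "C lam s w * F (lam, v) \<in> span {g lam s v}"
    by (rule C_F_in) (use assms in \<open>auto simp: g_F ideal_F span_zero span_base\<close>)
  then show thesis using that by (auto simp: span_singleton)
qed

lemma C_F_other:
  assumes "lam \<in> \<Lambda>" "s \<in> T lam" "w \<in> T lam" "mu \<in> \<Lambda>" "v \<in> T mu" "mu \<noteq> lam"
  shows "C lam s w * F (mu, v) \<in> ideal lam"
  by (rule C_F_in) (use assms in \<open>auto simp: g_F subspace_ideal subspace_0 ideal_mult_right\<close>)

section \<open>The seminormal basis over a field\<close>

definition f :: "'l \<Rightarrow> 's \<Rightarrow> 's \<Rightarrow> 'a" where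
  "f lam s t = F (lam, s) * C lam s t * F (lam, t)"

lemma f_conv_g: "f lam s t = F (lam, s) * g lam s t"
  by (simp add: f_def g_def mult.assoc)

lemma star_f: "\<lbrakk>lam \<in> \<Lambda>; s \<in> T lam; t \<in> T lam\<rbrakk> \<Longrightarrow> star (f lam s t) = f lam t s"
  by (simp add: f_def star_mult star_F star_C mult.assoc)

definition fbasis :: "'a set" where
  "fbasis = (\<lambda>(lam, s, t). f lam s t) ` cell_index \<Lambda> T"

lemma f_in_fbasis: "\<lbrakk>lam \<in> \<Lambda>; s \<in> T lam; t \<in> T lam\<rbrakk> \<Longrightarrow> f lam s t \<in> fbasis"
  by (force simp: fbasis_def cell_index_def)

text \<open>Write \<open>g lam s t\<close> as the sum of all \<open>F p * g lam s t\<close>. The statements about \<open>C lam t s * F p\<close> turn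
  under the anti-involution into statements about \<open>F p * C lam s t\<close>: if \<open>p = (lam, u)\<close> the summand is
  a multiple of \<open>f lam u t\<close>, and if \<open>p\<close> lies in another layer, then \<open>F p * C lam s t\<close> is in the cell
  ideal and is killed by \<open>F (lam, t)\<close>.\<close>

lemma span_fbasis: "span fbasis = UNIV"
proof -
  have "g lam s t \<in> span fbasis" if lam: "lam \<in> \<Lambda>" "s \<in> T lam" "t \<in> T lam" for lam s t
  proof -
    have summand: "F (mu, u) * g lam s t \<in> span fbasis" if u: "mu \<in> \<Lambda>" "u \<in> T mu" for mu u
    proof (cases "mu = lam")
      case True
      obtain k where "C lam t s * F (lam, u) = scale k (g lam t u)"
        using C_F_same lam u True by metis
      then have "star (C lam t s * F (lam, u)) = star (scale k (C lam t u * F (lam, u)))"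
        by (simp add: g_def)
      then have "F (lam, u) * C lam s t = scale k (F (lam, u) * C lam u t)"
        using lam u True by (simp add: star_mult star_F star_C star.scale)
      then have "F (lam, u) * g lam s t = scale k (f lam u t)"
        by (simp add: g_def f_def scale_mult_left flip: mult.assoc)
      then show ?thesis
        using f_in_fbasis u lam True by (simp add: span_scale span_base)
    next
      case False
      have "star (C lam t s * F (mu, u)) \<in> ideal lam"
        using C_F_other u lam False by (intro star_ideal) auto
      then have "F (mu, u) * C lam s t \<in> ideal lam"
        using lam by (simp add: star_mult star_F star_C)
      then have "F (mu, u) * g lam s t = 0"
        using ideal_F lam by (simp add: g_def flip: mult.assoc)
      then show ?thesis by (simp add: span_zero)
    qed
    have "g lam s t = (\<Sum>p\<in>tabs. F p * g lam s t)"
      by (simp add: sum_F flip: sum_distrib_right)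
    then show ?thesis
      using summand by (metis (no_types, lifting) SigmaE span_sum)
  qed
  then show ?thesis
    using g_spans[OF subspace_span] by blast
qed

text \<open>A spanning family indexed by as many elements as a basis has can have neither repetitions nor
  linear relations.\<close>

lemma card_fbasis: "card fbasis = card basis"
  and independent_fbasis: "independent fbasis"
proof -
  interpret finite_dimensional_vector_space scale basis
    by (intro finite_dimensional_vector_space.intro finite_dimensional_vector_space_axioms.intro)
      (simp_all add: finite_basis independent_basis span_basis module_axioms flip: module_iff_vector_space)
  have dim: "dim UNIV = card basis"
    by (simp add: dim_UNIV)
  have fin: "finite fbasis" by (simp add: fbasis_def finite_index)
  have "card fbasis \<le> card (cell_index \<Lambda> T)"
    unfolding fbasis_def by (rule card_image_le[OF finite_index])
  then have le: "card fbasis \<le> card basis"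
    by (simp add: basis_def card_image[OF inj_C])
  moreover have "dim UNIV \<le> card fbasis"
    using dim_le_card[of UNIV fbasis] fin span_fbasis by simp
  ultimately show "card fbasis = card basis" using dim by simp
  show "independent fbasis"
    by (rule card_le_dim_spanning[of _ UNIV]) (use fin le dim span_fbasis in auto)
qed

lemma inj_f: "inj_on (\<lambda>(lam, s, t). f lam s t) (cell_index \<Lambda> T)"
  using card_fbasis
  by (intro eq_card_imp_inj_on) (simp_all add: finite_index fbasis_def basis_def card_image[OF inj_C])

lemma f_nonzero: "\<lbrakk>lam \<in> \<Lambda>; s \<in> T lam; t \<in> T lam\<rbrakk> \<Longrightarrow> f lam s t \<noteq> 0"
  using dependent_zero independent_fbasis f_in_fbasis by metis

lemma f_mult_zero:
  assumes "lam \<in> \<Lambda>" "mu \<in> \<Lambda>" "t \<in> T lam" "u \<in> T mu" "(lam, t) \<noteq> (mu, u)"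
  shows "f lam s t * f mu u v = 0"
proof -
  have "f lam s t * f mu u v = F (lam, s) * C lam s t * (F (lam, t) * F (mu, u)) * C mu u v * F (mu, v)"
    by (simp add: f_def mult.assoc)
  moreover have "F (lam, t) * F (mu, u) = 0"
    using F_orthogonal[of "(lam, t)" "(mu, u)"] assms by auto
  ultimately show ?thesis by simp
qed

text \<open>Put \<open>y = C lam s t * f lam t v\<close>, so that the product in question is \<open>F (lam, s) * y\<close>. The cellular
  rule expands \<open>y\<close> modulo the cell ideal with coefficients \<open>r w\<close> that are the same for all \<open>s\<close>. On
  the other hand \<open>y\<close> is fixed by \<open>F (lam, v)\<close>, so it is a multiple \<open>k\<close> of \<open>g lam s v\<close>. Comparing the
  coefficients of \<open>C lam s v\<close> gives \<open>k = r v\<close>, which is independent of \<open>s\<close>.\<close>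

lemma f_mult_left_uniform:
  assumes lam: "lam \<in> \<Lambda>" "t \<in> T lam" "v \<in> T lam"
  obtains k where "\<And>s. s \<in> T lam \<Longrightarrow> f lam s t * f lam t v = scale k (f lam s v)"
proof -
  obtain r where r: "\<And>s. s \<in> T lam \<Longrightarrow>
      C lam s t * f lam t v - (\<Sum>w\<in>T lam. scale (r w) (C lam s w)) \<in> ideal lam"
    using cell_action[OF lam(1,2)] by blast
  have "f lam s t * f lam t v = scale (r v) (f lam s v)" if s: "s \<in> T lam" for s
  proof -
    define y where "y = C lam s t * f lam t v"
    \<comment> \<open>Congruence modulo \<open>R\<close> is equality of the coefficients of \<open>C lam s v\<close>.\<close>
    define R where "R = span (basis - {C lam s v})"
    have R: "subspace R" by (simp add: R_def)
    have C_R: "C mu u w \<in> R" if "mu \<in> \<Lambda>" "u \<in> T mu" "w \<in> T mu" "(mu, w) \<noteq> (lam, v)" for mu u w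
      unfolding R_def using that lam s C_eq_iff basisI by (intro span_base) auto
    have "higher lam s v \<subseteq> R"
    proof (rule higher_minimal[OF R])
      fix mu u w
      assume "mu \<in> \<Lambda>" "u \<in> T mu" "w \<in> T mu" and d: "dominates (mu, w) (lam, v)"
      moreover have "(mu, w) \<noteq> (lam, v)"
        using d dominates_irrefl[of "(lam, v)"] lam by auto
      ultimately show "C mu u w \<in> R" using C_R by blast
    qed
    then have g_R: "g lam s v - C lam s v \<in> R"
      using g_triangular lam s by blast
    have y_R: "y - (\<Sum>w\<in>T lam. scale (r w) (C lam s w)) \<in> R"
      using r[OF s] \<open>higher lam s v \<subseteq> R\<close> ideal_higher lam unfolding y_def by blast
    have "y * F (lam, v) = y"
      using lam F_orthogonal[of "(lam, v)" "(lam, v)"]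
      by (simp add: y_def f_def mult.assoc)
    moreover have "(y - (\<Sum>w\<in>T lam. scale (r w) (C lam s w))) * F (lam, v) = 0"
      using r[OF s] lam ideal_F by (simp add: y_def)
    ultimately have y: "y = (\<Sum>w\<in>T lam. scale (r w) (C lam s w * F (lam, v)))"
      by (simp add: left_diff_distrib sum_distrib_right scale_mult_left)
    have "C lam s w * F (lam, v) \<in> span {g lam s v}" if "w \<in> T lam" for w
      using C_F_same lam s that by (metis rangeI span_singleton)
    then have "y \<in> span {g lam s v}"
      unfolding y by (intro span_sum span_scale)
    then obtain k where k: "y = scale k (g lam s v)"
      by (auto simp: span_singleton)
    have "(\<Sum>w\<in>T lam. scale (r w) (C lam s w)) =
        scale (r v) (C lam s v) + (\<Sum>w\<in>T lam - {v}. scale (r w) (C lam s w))"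
      by (rule sum.remove[OF finite_T[OF lam(1)] lam(3)])
    then have "scale (k - r v) (C lam s v) =
        (y - (\<Sum>w\<in>T lam. scale (r w) (C lam s w))) + (\<Sum>w\<in>T lam - {v}. scale (r w) (C lam s w))
        - scale k (g lam s v - C lam s v)"
      by (simp add: k scale_left_diff_distrib scale_right_diff_distrib)
    also have "\<dots> \<in> R"
      by (rule subspace_diff[OF R subspace_add[OF R y_R] subspace_scale[OF R g_R]],
          rule subspace_sum[OF R], rule subspace_scale[OF R]) (use C_R lam s in auto)
    finally have "scale (k - r v) (C lam s v) \<in> R" .
    then have "scale (inverse (k - r v)) (scale (k - r v) (C lam s v)) \<in> R"
      by (rule subspace_scale[OF R])
    moreover have "C lam s v \<notin> R"
      using independent_basis basisI lam s unfolding R_def dependent_def by blast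
    ultimately have "k = r v"
      by (cases "k = r v") auto
    have "f lam s t * f lam t v = F (lam, s) * C lam s t * (F (lam, t) * F (lam, t)) * C lam t v * F (lam, v)"
      by (simp add: f_def mult.assoc)
    also have "\<dots> = F (lam, s) * y"
      using lam F_orthogonal by (simp add: y_def f_def mult.assoc)
    finally show ?thesis
      by (simp add: k \<open>k = r v\<close> scale_mult_right f_conv_g)
  qed
  then show thesis using that by blast
qed

text \<open>Applying the anti-involution to \<open>f lam t t * f lam t v\<close> identifies the factor for \<open>v\<close> with the one
  for \<open>t\<close>. The cancellation uses that \<open>f lam v t\<close> is not zero, as a member of a basis.\<close>

theorem f_mult:
  "\<exists>\<gamma>. \<forall>lam\<in>\<Lambda>. \<forall>mu\<in>\<Lambda>. \<forall>s\<in>T lam. \<forall>t\<in>T lam. \<forall>u\<in>T mu. \<forall>v\<in>T mu.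
    f lam s t * f mu u v = (if lam = mu \<and> t = u then scale (\<gamma> (lam, t)) (f lam s v) else 0)"
proof -
  have "\<forall>lam t v. \<exists>k. lam \<in> \<Lambda> \<and> t \<in> T lam \<and> v \<in> T lam \<longrightarrow>
      (\<forall>s\<in>T lam. f lam s t * f lam t v = scale k (f lam s v))"
    using f_mult_left_uniform by metis
  then obtain k where k: "\<And>lam t v s. \<lbrakk>lam \<in> \<Lambda>; t \<in> T lam; v \<in> T lam; s \<in> T lam\<rbrakk> \<Longrightarrow>
      f lam s t * f lam t v = scale (k lam t v) (f lam s v)"
    by metis
  have k_const: "k lam t v = k lam t t" if lam: "lam \<in> \<Lambda>" "t \<in> T lam" "v \<in> T lam" for lam t v
  proof -
    have "f lam v t * f lam t t = star (f lam t t * f lam t v)"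
      by (simp add: star_mult star_f lam)
    also have "\<dots> = scale (k lam t v) (f lam v t)"
      by (simp add: k star.scale star_f lam)
    finally have "scale (k lam t t) (f lam v t) = scale (k lam t v) (f lam v t)"
      by (simp add: k lam)
    then show ?thesis
      using f_nonzero lam by simp
  qed
  show ?thesis
  proof (intro exI[of _ "\<lambda>p. k (fst p) (snd p) (snd p)"] ballI)
    fix lam mu s t u v
    assume idx: "lam \<in> \<Lambda>" "mu \<in> \<Lambda>" "s \<in> T lam" "t \<in> T lam" "u \<in> T mu" "v \<in> T mu"
    show "f lam s t * f mu u v = (if lam = mu \<and> t = u
        then scale (k (fst (lam, t)) (snd (lam, t)) (snd (lam, t))) (f lam s v) else 0)"
    proof (cases "lam = mu \<and> t = u")
      case True
      then show ?thesis using idx k[of lam t v s] k_const[of lam t v] by simp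
    next
      case False
      then show ?thesis using f_mult_zero[of lam mu t u s v] idx by auto
    qed
  qed
qed

text \<open>The multiplication rule yields the cellular axiom without any error term. The linear map that
  swaps the indices of \<open>f\<close> is the old anti-involution, since \<open>star\<close> fixes the idempotents.\<close>

theorem f_cell_datum: "cell_datum scale \<Lambda> gt T f"
proof -
  obtain \<gamma> where "\<forall>lam\<in>\<Lambda>. \<forall>mu\<in>\<Lambda>. \<forall>s\<in>T lam. \<forall>t\<in>T lam. \<forall>u\<in>T mu. \<forall>v\<in>T mu.
      f lam s t * f mu u v = (if lam = mu \<and> t = u then scale (\<gamma> (lam, t)) (f lam s v) else 0)"
    using f_mult ..
  note \<gamma> = this[rule_format]
  have action: "\<exists>r. \<forall>s\<in>T lam. f lam s t * x = (\<Sum>v\<in>T lam. scale (r v) (f lam s v))"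
    if lam: "lam \<in> \<Lambda>" "t \<in> T lam" for x lam t
  proof -
    have "x \<in> span fbasis" by (simp add: span_fbasis)
    then show ?thesis
    proof (induction rule: span_induct_alt)
      case base
      show ?case by (rule exI[of _ "\<lambda>_. 0"]) simp
    next
      case (step k b x)
      then obtain mu u v where b: "b = f mu u v" and mu: "mu \<in> \<Lambda>" "u \<in> T mu" "v \<in> T mu"
        by (auto simp: fbasis_def cell_index_def)
      obtain r where r: "\<forall>s\<in>T lam. f lam s t * x = (\<Sum>v\<in>T lam. scale (r v) (f lam s v))"
        using step by blast
      show ?case
      proof (cases "lam = mu \<and> t = u")
        case True
        define r' where "r' w = r w + (if w = v then k * \<gamma> (lam, t) else 0)" for w
        have "f lam s t * (scale k b + x) = (\<Sum>w\<in>T lam. scale (r' w) (f lam s w))"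
          if s: "s \<in> T lam" for s
        proof -
          have "(\<Sum>w\<in>T lam. scale (r' w) (f lam s w)) =
              (\<Sum>w\<in>T lam. scale (r w) (f lam s w)) +
              (\<Sum>w\<in>T lam. if w = v then scale (k * \<gamma> (lam, t)) (f lam s w) else 0)"
            by (simp add: r'_def scale_left_distrib flip: sum.distrib) (intro sum.cong, auto)
          then show ?thesis
            using True mu lam s r \<gamma> finite_T
            by (simp add: distrib_left scale_mult_right b add.commute)
        qed
        then show ?thesis by blast
      next
        case False
        then have "f lam s t * b = 0" if "s \<in> T lam" for s
          using \<gamma> mu lam that b by auto
        then have "\<forall>s\<in>T lam. f lam s t * (scale k b + x) = (\<Sum>v\<in>T lam. scale (r v) (f lam s v))"
          using r by (simp add: distrib_left scale_mult_right)
        then show ?thesis by blast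
      qed
    qed
  qed
  have star: "cell_star scale \<Lambda> T f = star"
    by (rule cell_star_eqI) (simp_all add: star_hom star_f span_fbasis flip: fbasis_def)
  have zero: "0 \<in> cell_ideal scale \<Lambda> gt T f lam" for lam
    by (simp add: cell_ideal_def span_zero)
  have congruence: "\<exists>r. \<forall>s\<in>T lam. f lam s t * x - (\<Sum>v\<in>T lam. scale (r v) (f lam s v))
      \<in> cell_ideal scale \<Lambda> gt T f lam" if lam: "lam \<in> \<Lambda>" "t \<in> T lam" for x lam t
  proof -
    obtain r where "\<forall>s\<in>T lam. f lam s t * x = (\<Sum>v\<in>T lam. scale (r v) (f lam s v))"
      using action[OF lam] ..
    then have "\<forall>s\<in>T lam. f lam s t * x - (\<Sum>v\<in>T lam. scale (r v) (f lam s v))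
        \<in> cell_ideal scale \<Lambda> gt T f lam"
      using zero by simp
    then show ?thesis by (rule exI[of _ r])
  qed
  show ?thesis
    using cellular inj_f independent_fbasis span_fbasis congruence
    by (simp add: cell_datum_def star flip: fbasis_def)
qed

end

section \<open>The seminormal basis of the scalar extension\<close>

theorem theorem3p7:
  fixes sR :: "'r::idom \<Rightarrow> 'a::{ring,monoid_mult} \<Rightarrow> 'a"
    and sK :: "'r fract \<Rightarrow> 'b::{ring,monoid_mult} \<Rightarrow> 'b"
    and \<tau> :: "'a \<Rightarrow> 'r fract \<Rightarrow> 'b"
    and \<Lambda> :: "'l set" and gt :: "'l \<Rightarrow> 'l \<Rightarrow> bool"
    and T :: "'l \<Rightarrow> 's set" and C :: "'l \<Rightarrow> 's \<Rightarrow> 's \<Rightarrow> 'a"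
    and tgt :: "'l \<Rightarrow> 's \<Rightarrow> 's \<Rightarrow> bool"
    and M :: nat and L :: "nat \<Rightarrow> 'a" and c :: "'l \<times> 's \<Rightarrow> nat \<Rightarrow> 'r"
  assumes cellular: "cell_datum sR \<Lambda> gt T C"
    and tgt_order: "\<And>lam. lam \<in> \<Lambda> \<Longrightarrow> strict_poset (T lam) (tgt lam)"
    and JM: "JM_family sR \<Lambda> gt T C tgt M L c"
    and separate: "JM_separate \<Lambda> T M c"
    and A_K: "is_scalar_extension sR sK \<tau>"
  shows "(\<exists>\<gamma> :: 'l \<times> 's \<Rightarrow> 'r fract.
            \<forall>lam\<in>\<Lambda>. \<forall>mu\<in>\<Lambda>. \<forall>s\<in>T lam. \<forall>t\<in>T lam. \<forall>u\<in>T mu. \<forall>v\<in>T mu.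
              f_elt sK \<tau> \<Lambda> T C M L c lam s t * f_elt sK \<tau> \<Lambda> T C M L c mu u v =
                (if lam = mu \<and> t = u then sK (\<gamma> (lam, t)) (f_elt sK \<tau> \<Lambda> T C M L c lam s v) else 0)) \<and>
         cell_datum sK \<Lambda> gt T (f_elt sK \<tau> \<Lambda> T C M L c)"
proof -
  interpret E: scalar_extension sR \<Lambda> gt T C sK \<tau>
    by unfold_locales (fact cellular A_K)+
  interpret J: separated_JM sK \<Lambda> gt T "\<lambda>lam s t. E.\<iota> (C lam s t)" tgt M "\<lambda>i. E.\<iota> (L i)"
    "\<lambda>p i. to_fract (c p i)"
  proof
    show "cell_datum sK \<Lambda> gt T (\<lambda>lam s t. E.\<iota> (C lam s t))"
      by (rule E.scalar_extension_cell_datum)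
    show "JM_family sK \<Lambda> gt T (\<lambda>lam s t. E.\<iota> (C lam s t)) tgt M (\<lambda>i. E.\<iota> (L i))
        (\<lambda>p i. to_fract (c p i))"
      by (rule E.scalar_extension_JM_family[OF JM])
    show "JM_separate \<Lambda> T M (\<lambda>p i. to_fract (c p i))"
      using separate by (simp add: JM_separate_def)
  qed (fact tgt_order)
  \<comment> \<open>The same polynomials, with the contents in \<open>R\<close> or their images in \<open>K\<close> as index set.\<close>
  have other_contents: "J.other_contents p i = to_fract ` {d \<in> contents \<Lambda> T c i. d \<noteq> c p i}" for p i
    by (auto simp: J.other_contents_def contents_def)
  have inj: "inj_on to_fract D" for D :: "'r set"
    by (auto intro: inj_onI)
  have "J.F p = F_elt sK \<tau> \<Lambda> T M L c p" for p
    by (simp only: J.F_def F_elt_def other_contents commuting_prod_reindex[OF inj] J.factor_def)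
      (simp only: E.\<iota>_def)
  then have f: "J.f = f_elt sK \<tau> \<Lambda> T C M L c"
    by (simp only: J.f_def f_elt_def fun_eq_iff simp_thms) (simp only: E.\<iota>_def simp_thms)
  show ?thesis
    using J.f_mult J.f_cell_datum unfolding f by (rule conjI)
qed

end
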